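(* Let $L>0$, let $a$ satisfy (H_a), $g\in L^2(0,L)$, and let $\phi$ satisfy (H_φ) together with $\phi(0)=+\infty$. Let $(a_n,g_n,\phi_n)$ be approximating data satisfying (H_approx). Then for every $n$ there exists at least one function $u_n$ satisfying $$u_n\in H^1_0(0,L),\qquad \int_0^L a_n u_n' z'\,dx=\int_0^L\phi_n(u_n) z'\,dx+\int_0^L g_n z'\,dx\quad\forall z\in H^1_0(0,L),$$ and every such $u_n$ satisfies $\|u_n'\|_{L^2(0,L)}\le \frac{1}{\alpha}\|g_n\|_{L^2(0,L)}\le \frac{c_0}{\alpha}$. Moreover, if a subsequence $u_{n'}$ of such functions converges weakly in $H^1_0(0,L)$ (and a.e.) to some $u\in H^1_0(0,L)$, then either $u\equiv 0$, or $u$ is a weak solution of problem (P) with data $(a,g,\phi)$.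
   Context: Prime denotes $d/dx$. (H_a): $a\in L^\infty(0,L)$ and there are constants $0<\alpha<\beta$ with $\alpha\le a(x)\le\beta$ for a.e. $x\in(0,L)$. (H_φ): $\phi:\mathbb{R}\to\mathbb{R}\cup\{+\infty\}$ is continuous when $\mathbb{R}\cup\{+\infty\}$ carries its usual topology (neighbourhoods of $+\infty$ contain some $(M,+\infty]$), and $\phi(s)<+\infty$ for every $s\neq 0$. Problem (P) with data $(a,g,\phi)$ is formally $-\frac{d}{dx}(a\frac{du}{dx})=-\frac{d\phi(u)}{dx}-\frac{dg}{dx}$ in $(0,L)$, $u(0)=u(L)=0$. A weak solution of (P) is a function $u$ with $u\in H^1_0(0,L)$, $\phi(u)\in L^2(0,L)$, and $-\frac{d}{dx}(a\frac{du}{dx})=-\frac{d\phi(u)}{dx}-\frac{dg}{dx}$ in $\mathcal D'(0,L)$. A sequence $(\phi_n)$ is a reasonable approximation of $\phi$ if each $\phi_n$ satisfies (H_φ) and, for every real sequence $s_n\to s\in\mathbb{R}$, one has $\phi_n(s_n)\to\phi(s)$ in $\mathbb{R}\cup\{+\infty\}$. (H_approx): $a_n\in L^\infty(0,L)$ with $\alpha\le a_n\le\beta$ a.e. (same $\alpha,\beta$) and $a_n\to a$ a.e. in $(0,L)$; $g_n\in L^2(0,L)$ with $\|g_n\|_{L^2}\le c_0$ for a fixed $c_0>0$ and $g_n\rightharpoonup g$ weakly in $L^2(0,L)$; $(\phi_n)$ is a reasonable approximation of $\phi$ and $\phi_n\in C^0(\mathbb{R})$ (real-valued continuous) for each $n$.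 *)

theory Defs
  imports "HOL-Analysis.Analysis"
begin

text \<open>All function spaces are over the open interval (0,L); functions are total
  real functions whose values outside (0,L) are irrelevant.\<close>

definition L2 :: "real \<Rightarrow> (real \<Rightarrow> real) \<Rightarrow> bool" where
  "L2 L f \<longleftrightarrow> set_borel_measurable lborel {0<..<L} f \<and>
                set_integrable lborel {0<..<L} (\<lambda>x. (f x)\<^sup>2)"

definition L2norm :: "real \<Rightarrow> (real \<Rightarrow> real) \<Rightarrow> real" where
  "L2norm L f = sqrt (LINT x:{0<..<L}|lborel. (f x)\<^sup>2)"

definition test_fun :: "real \<Rightarrow> (real \<Rightarrow> real) \<Rightarrow> bool" where
  "test_fun L \<psi> \<longleftrightarrow> (\<forall>k x. ((deriv ^^ k) \<psi>) differentiable (at x)) \<and>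
     (\<exists>c d. 0 < c \<and> c \<le> d \<and> d < L \<and> (\<forall>x. x \<notin> {c..d} \<longrightarrow> \<psi> x = 0))"

definition weak_deriv :: "real \<Rightarrow> (real \<Rightarrow> real) \<Rightarrow> (real \<Rightarrow> real) \<Rightarrow> bool" where
  "weak_deriv L u du \<longleftrightarrow>
     (\<forall>\<psi>. test_fun L \<psi> \<longrightarrow>
        (LINT x:{0<..<L}|lborel. u x * deriv \<psi> x) = - (LINT x:{0<..<L}|lborel. du x * \<psi> x))"

definition H10 :: "real \<Rightarrow> (real \<Rightarrow> real) \<Rightarrow> (real \<Rightarrow> real) \<Rightarrow> bool" where
  "H10 L u du \<longleftrightarrow> L2 L u \<and> L2 L du \<and> weak_deriv L u du \<and>
     (\<exists>w. continuous_on {0..L} w \<and> w 0 = 0 \<and> w L = 0 \<and>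
          (AE x in lborel. x \<in> {0<..<L} \<longrightarrow> u x = w x))"

text \<open>Weak convergence in H^1_0(0,L) (Hilbert space with the H^1 inner product).\<close>
definition weak_conv_H10 :: "real \<Rightarrow> (nat \<Rightarrow> real \<Rightarrow> real) \<Rightarrow> (nat \<Rightarrow> real \<Rightarrow> real)
     \<Rightarrow> (real \<Rightarrow> real) \<Rightarrow> (real \<Rightarrow> real) \<Rightarrow> bool" where
  "weak_conv_H10 L U DU u du \<longleftrightarrow>
     (\<forall>z dz. H10 L z dz \<longrightarrow>
        (\<lambda>k. LINT x:{0<..<L}|lborel. U k x * z x + DU k x * dz x)
          \<longlonglongrightarrow> (LINT x:{0<..<L}|lborel. u x * z x + du x * dz x))"

definition weak_conv_L2 :: "real \<Rightarrow> (nat \<Rightarrow> real \<Rightarrow> real) \<Rightarrow> (real \<Rightarrow> real) \<Rightarrow> bool" where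
  "weak_conv_L2 L G g \<longleftrightarrow>
     (\<forall>h. L2 L h \<longrightarrow> (\<lambda>n. LINT x:{0<..<L}|lborel. G n x * h x)
                         \<longlonglongrightarrow> (LINT x:{0<..<L}|lborel. g x * h x))"

definition H_a :: "real \<Rightarrow> real \<Rightarrow> real \<Rightarrow> (real \<Rightarrow> real) \<Rightarrow> bool" where
  "H_a L \<alpha> \<beta> a \<longleftrightarrow> 0 < \<alpha> \<and> \<alpha> < \<beta> \<and> set_borel_measurable lborel {0<..<L} a \<and>
     (AE x in lborel. x \<in> {0<..<L} \<longrightarrow> \<alpha> \<le> a x \<and> a x \<le> \<beta>)"

definition H_phi :: "(real \<Rightarrow> ereal) \<Rightarrow> bool" where
  "H_phi \<phi> \<longleftrightarrow> continuous_on UNIV \<phi> \<and> (\<forall>s. \<phi> s \<noteq> -\<infinity>) \<and> (\<forall>s. s \<noteq> 0 \<longrightarrow> \<phi> s \<noteq> \<infinity>)"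

definition reasonable_approx :: "(nat \<Rightarrow> real \<Rightarrow> ereal) \<Rightarrow> (real \<Rightarrow> ereal) \<Rightarrow> bool" where
  "reasonable_approx \<Phi> \<phi> \<longleftrightarrow> (\<forall>n. H_phi (\<Phi> n)) \<and>
     (\<forall>s s0. s \<longlonglongrightarrow> s0 \<longrightarrow> (\<lambda>n. \<Phi> n (s n)) \<longlonglongrightarrow> \<phi> s0)"

definition H_approx :: "real \<Rightarrow> real \<Rightarrow> real \<Rightarrow> real \<Rightarrow> (real \<Rightarrow> real) \<Rightarrow> (real \<Rightarrow> real)
     \<Rightarrow> (real \<Rightarrow> ereal) \<Rightarrow> (nat \<Rightarrow> real \<Rightarrow> real) \<Rightarrow> (nat \<Rightarrow> real \<Rightarrow> real)
     \<Rightarrow> (nat \<Rightarrow> real \<Rightarrow> real) \<Rightarrow> bool" where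
  "H_approx L \<alpha> \<beta> c0 a g \<phi> an gn \<phi>n \<longleftrightarrow>
     (\<forall>n. set_borel_measurable lborel {0<..<L} (an n) \<and>
          (AE x in lborel. x \<in> {0<..<L} \<longrightarrow> \<alpha> \<le> an n x \<and> an n x \<le> \<beta>)) \<and>
     (AE x in lborel. x \<in> {0<..<L} \<longrightarrow> (\<lambda>n. an n x) \<longlonglongrightarrow> a x) \<and>
     0 < c0 \<and> (\<forall>n. L2 L (gn n) \<and> L2norm L (gn n) \<le> c0) \<and> weak_conv_L2 L gn g \<and>
     reasonable_approx (\<lambda>n s. ereal (\<phi>n n s)) \<phi> \<and> (\<forall>n. continuous_on UNIV (\<phi>n n))"

definition approx_sol :: "real \<Rightarrow> (real \<Rightarrow> real) \<Rightarrow> (real \<Rightarrow> real) \<Rightarrow> (real \<Rightarrow> real)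
     \<Rightarrow> (real \<Rightarrow> real) \<Rightarrow> (real \<Rightarrow> real) \<Rightarrow> bool" where
  "approx_sol L a g \<phi> u du \<longleftrightarrow> H10 L u du \<and>
     (\<forall>z dz. H10 L z dz \<longrightarrow>
        (LINT x:{0<..<L}|lborel. a x * du x * dz x) =
          (LINT x:{0<..<L}|lborel. \<phi> (u x) * dz x) + (LINT x:{0<..<L}|lborel. g x * dz x))"

text \<open>Weak solution of (P): u in H^1_0, phi(u) in L^2 (in particular finite a.e.),
  and the equation holds in D'(0,L).\<close>
definition weak_sol :: "real \<Rightarrow> (real \<Rightarrow> real) \<Rightarrow> (real \<Rightarrow> real) \<Rightarrow> (real \<Rightarrow> ereal)
     \<Rightarrow> (real \<Rightarrow> real) \<Rightarrow> (real \<Rightarrow> real) \<Rightarrow> bool" where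
  "weak_sol L a g \<phi> u du \<longleftrightarrow> H10 L u du \<and>
     (AE x in lborel. x \<in> {0<..<L} \<longrightarrow> \<phi> (u x) \<noteq> \<infinity>) \<and>
     L2 L (\<lambda>x. real_of_ereal (\<phi> (u x))) \<and>
     (\<forall>\<psi>. test_fun L \<psi> \<longrightarrow>
        (LINT x:{0<..<L}|lborel. a x * du x * deriv \<psi> x) =
          (LINT x:{0<..<L}|lborel. real_of_ereal (\<phi> (u x)) * deriv \<psi> x)
          + (LINT x:{0<..<L}|lborel. g x * deriv \<psi> x))"

end

theory Submission
  imports Defs "HOL-Complex_Analysis.Great_Picard"
begin

text \<open>Integrating once, \<open>u\<close> solves the problem with a continuous nonlinearity \<open>\<phi>\<close> iff
  \<open>a u' = \<phi>(u) + g + C\<close> a.e. for some constant \<open>C\<close>. For bounded \<open>\<phi>\<close>, replace \<open>\<phi>(u(t))\<close> by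
  \<open>\<phi>(u(t - h))\<close>: the delayed equation is solved step by step from \<open>u(0) = 0\<close>, depends continuously
  on \<open>C\<close>, and the intermediate value theorem gives \<open>u(L) = 0\<close>; then \<open>h\<close> tends to 0 by
  Arzela-Ascoli. Since \<open>\<phi>(u) u'\<close> integrates to zero, the energy estimate is independent of
  \<open>\<phi>\<close>, so a general \<open>\<phi>\<close> may be truncated. In the limit, if \<open>u\<close> is not identically zero, then
  on a set of positive measure the \<open>\<phi>\<^sub>n(u\<^sub>n)\<close> stay bounded, which bounds the constants \<open>C\<^sub>n\<close>;
  hence \<open>\<phi>\<^sub>n(u\<^sub>n)\<close> is bounded in L2 on the whole interval, Fatou's lemma puts \<open>\<phi>(u)\<close> in L2, and
  boundedness in L2 with a.e. convergence suffices to pass to the limit in the equation.\<close>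

section \<open>Lebesgue integration on the interval\<close>

text \<open>For a merely continuous \<phi> the integrated equation may have several solutions with
  u(0) = 0, so shooting in C has no well-defined end value; the delay restores uniqueness and
  continuity in C, at the price of a compactness argument afterwards. The constant C appears because
  the derivatives of H^1_0 functions are exactly the mean-zero L2 functions, whose orthogonal
  complement consists of the constants. Functions of H^1_0 are handled as primitives of their weak
  derivatives; since these are only integrable, the chain rule behind the vanishing of the integral
  of \<phi>(u) u' is proved on increments and not by pointwise differentiation. In the limit the
  obstacle is that the energy estimate bounds a_n u_n' - g_n in L2, hence only the sum of
  \<phi>_n(u_n) and C_n: as \<phi> is infinite at 0, the two could diverge with opposite signs. This
  is possible only if u vanishes a.e., whence the alternative in the theorem. The product a_n u_n'
  is a strong times a weak limit, with a_n attached to the test function.\<close>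

abbreviation intv :: "real \<Rightarrow> real measure" where
  "intv L \<equiv> restrict_space lborel {0<..<L}"

lemma space_intv [simp]: "space (intv L) = {0<..<L}"
  by (simp add: space_restrict_space)

lemma finite_measure_intv: "finite_measure (intv L)"
  by (rule finite_measureI, cases "0 \<le> L") (simp_all add: emeasure_restrict_space)

lemma measure_intv: "0 \<le> L \<Longrightarrow> measure (intv L) {0<..<L} = L"
  by (simp add: measure_restrict_space)

lemma set_lint_intv: "(LINT x:{0<..<L}|lborel. f x) = (LINT x|intv L. (f x :: real))"
  by (simp add: set_lebesgue_integral_def integral_restrict_space)

lemma set_integrable_intv: "set_integrable lborel {0<..<L} f \<longleftrightarrow> integrable (intv L) (f :: real \<Rightarrow> real)"
  by (simp add: set_integrable_def integrable_restrict_space)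

lemma set_borel_measurable_intv:
  "set_borel_measurable lborel {0<..<L} f \<longleftrightarrow> (f :: real \<Rightarrow> real) \<in> borel_measurable (intv L)"
  by (simp add: set_borel_measurable_def borel_measurable_restrict_space_iff)

lemma AE_intv: "(AE x in intv L. P x) \<longleftrightarrow> (AE x in lborel. x \<in> {0<..<L} \<longrightarrow> P x)"
  by (simp add: AE_restrict_space_iff)

lemma borel_measurable_intv: "f \<in> borel_measurable borel \<Longrightarrow> f \<in> borel_measurable (intv L)"
  by (rule measurable_restrict_space1) simp

lemma L2_intv:
  "L2 L f \<longleftrightarrow> f \<in> borel_measurable (intv L) \<and> integrable (intv L) (\<lambda>x. (f x)\<^sup>2)"
  by (simp add: L2_def set_borel_measurable_intv set_integrable_intv)

lemma L2norm_intv: "L2norm L f = sqrt (LINT x|intv L. (f x)\<^sup>2)"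
  by (simp add: L2norm_def set_lint_intv)

lemma integrable_intv_const [simp]: "integrable (intv L) (\<lambda>x. c :: real)"
  using finite_measure.integrable_const[OF finite_measure_intv] .

lemma integrable_intv_bounded:
  fixes f :: "real \<Rightarrow> real"
  assumes "f \<in> borel_measurable (intv L)" "AE x in intv L. \<bar>f x\<bar> \<le> B"
  shows "integrable (intv L) f"
  by (rule finite_measure.integrable_const_bound[OF finite_measure_intv]) (use assms in auto)

lemma integrable_bounded_mult:
  fixes f h :: "'a \<Rightarrow> real"
  assumes "integrable M f" "h \<in> borel_measurable M" "AE x in M. \<bar>h x\<bar> \<le> B"
  shows "integrable M (\<lambda>x. h x * f x)"
proof (rule Bochner_Integration.integrable_bound[of M "\<lambda>x. B * f x"])
  show "integrable M (\<lambda>x. B * f x)" using assms by simp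
  show "(\<lambda>x. h x * f x) \<in> borel_measurable M" using assms by simp
  show "AE x in M. norm (h x * f x) \<le> norm (B * f x)"
    using assms(3) by eventually_elim (simp add: abs_mult mult_right_mono)
qed

lemma L2_mult_integrable:
  assumes "L2 L f" "L2 L h"
  shows "integrable (intv L) (\<lambda>x. f x * h x)"
proof (rule Bochner_Integration.integrable_bound[of _ "\<lambda>x. (f x)\<^sup>2 + (h x)\<^sup>2"])
  show "AE x in intv L. norm (f x * h x) \<le> norm ((f x)\<^sup>2 + (h x)\<^sup>2)"
  proof (intro AE_I2)
    fix x
    have "2 * \<bar>f x\<bar> * \<bar>h x\<bar> \<le> (f x)\<^sup>2 + (h x)\<^sup>2"
      using sum_squares_bound[of "\<bar>f x\<bar>" "\<bar>h x\<bar>"] by simp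
    moreover have "0 \<le> \<bar>f x\<bar> * \<bar>h x\<bar>" by simp
    ultimately have "\<bar>f x\<bar> * \<bar>h x\<bar> \<le> (f x)\<^sup>2 + (h x)\<^sup>2" by linarith
    then show "norm (f x * h x) \<le> norm ((f x)\<^sup>2 + (h x)\<^sup>2)"
      by (simp add: abs_mult)
  qed
qed (use assms in \<open>auto simp: L2_intv\<close>)

lemma L2_integrable: "L2 L f \<Longrightarrow> integrable (intv L) f"
  using L2_mult_integrable[of L f "\<lambda>_. 1"] by (simp add: L2_intv)

lemma L2_const [simp]: "L2 L (\<lambda>_. c)"
  by (simp add: L2_intv)

lemma L2_add: "L2 L f \<Longrightarrow> L2 L h \<Longrightarrow> L2 L (\<lambda>x. f x + h x)"
  using L2_mult_integrable[of L f h]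
  by (auto simp: L2_intv power2_sum mult.assoc intro!: borel_measurable_add)

lemma L2_diff: "L2 L f \<Longrightarrow> L2 L h \<Longrightarrow> L2 L (\<lambda>x. f x - h x)"
  using L2_mult_integrable[of L f h]
  by (auto simp: L2_intv power2_diff mult.assoc intro!: borel_measurable_diff)

lemma L2_bounded_mult:
  assumes "L2 L f" "h \<in> borel_measurable (intv L)" "AE x in intv L. \<bar>h x\<bar> \<le> B"
  shows "L2 L (\<lambda>x. h x * f x)"
proof -
  have "AE x in intv L. \<bar>(h x)\<^sup>2\<bar> \<le> B\<^sup>2"
    using assms(3) by eventually_elim (simp add: abs_le_square_iff[symmetric])
  then have "integrable (intv L) (\<lambda>x. (h x)\<^sup>2 * (f x)\<^sup>2)"
    using assms by (intro integrable_bounded_mult[where B = "B\<^sup>2"]) (auto simp: L2_intv)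
  then show ?thesis using assms by (simp add: L2_intv power_mult_distrib borel_measurable_times)
qed

lemma L2_bounded:
  assumes "h \<in> borel_measurable (intv L)" "AE x in intv L. \<bar>h x\<bar> \<le> B"
  shows "L2 L h"
  using L2_bounded_mult[OF L2_const[of L 1] assms] by simp

section \<open>Primitives of integrable functions: continuity, chain rule, integration by
  parts\<close>

text \<open>Putting the upper limit into an indicator keeps the measure fixed, so that dominated
  convergence applies directly, and makes the primitive total, with value 0 to the left of the
  interval. The delayed equations evaluate it at negative arguments.\<close>

definition prim :: "real \<Rightarrow> (real \<Rightarrow> real) \<Rightarrow> real \<Rightarrow> real" where
  "prim L v x = (LINT t|intv L. indicator {..x} t * v t)"

lemma integrable_indicator_mult:
  fixes v :: "real \<Rightarrow> real"
  assumes "integrable (intv L) v" "A \<in> sets borel"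
  shows "integrable (intv L) (\<lambda>t. indicator A t * v t)"
  by (rule integrable_bounded_mult[where B = 1])
    (use assms in \<open>auto intro!: borel_measurable_intv simp: indicator_def\<close>)

lemma prim_nonpos: "x \<le> 0 \<Longrightarrow> prim L v x = 0"
proof -
  assume "x \<le> 0"
  then have "prim L v x = (LINT t|intv L. 0)"
    unfolding prim_def by (intro Bochner_Integration.integral_cong) (auto simp: indicator_def)
  then show ?thesis by simp
qed

lemma prim_0 [simp]: "prim L v 0 = 0"
  by (simp add: prim_nonpos)

lemma prim_L: "prim L v L = (LINT t|intv L. v t)"
  unfolding prim_def by (intro Bochner_Integration.integral_cong) (auto simp: indicator_def)

lemma prim_diff:
  assumes "integrable (intv L) v" "x \<le> y"
  shows "prim L v y - prim L v x = (LINT t|intv L. indicator {x<..y} t * v t)"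
proof -
  have "prim L v y - prim L v x = (LINT t|intv L. indicator {..y} t * v t - indicator {..x} t * v t)"
    unfolding prim_def
    by (intro Bochner_Integration.integral_diff[symmetric] integrable_indicator_mult assms) auto
  also have "\<dots> = (LINT t|intv L. indicator {x<..y} t * v t)"
    using assms by (intro Bochner_Integration.integral_cong) (auto simp: indicator_def)
  finally show ?thesis .
qed

text \<open>A family of primitives with one integrable majorant \<open>G\<close> inherits the
  increments of \<open>prim L G\<close> as common modulus of continuity. This is the source of
  equicontinuity for Arzela-Ascoli.\<close>

lemma prim_diff_le:
  assumes v: "v \<in> borel_measurable (intv L)" and G: "integrable (intv L) G" "AE t in intv L. \<bar>v t\<bar> \<le> G t" and "x \<le> y"
  shows "\<bar>prim L v y - prim L v x\<bar> \<le> prim L G y - prim L G x"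
proof -
  have iv: "integrable (intv L) v"
    using G(2) by (intro Bochner_Integration.integrable_bound[OF G(1) v]) (auto elim!: eventually_mono)
  have "\<bar>prim L v y - prim L v x\<bar> \<le> (LINT t|intv L. indicator {x<..y} t * \<bar>v t\<bar>)"
    unfolding prim_diff[OF iv \<open>x \<le> y\<close>]
    using integral_abs_bound[of "intv L" "\<lambda>t. indicator {x<..y} t * v t"]
    by (simp add: abs_mult)
  also have "\<dots> \<le> (LINT t|intv L. indicator {x<..y} t * G t)"
    using G(2) by (intro integral_mono_AE integrable_indicator_mult integrable_abs iv G(1))
      (auto elim!: eventually_mono simp: indicator_def)
  also have "\<dots> = prim L G y - prim L G x" by (rule prim_diff[OF G(1) \<open>x \<le> y\<close>, symmetric])
  finally show ?thesis .
qed

lemma AE_intv_neq: "AE t in intv L. t \<noteq> x"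
  unfolding AE_intv using AE_lborel_singleton[of x] by eventually_elim simp

lemma prim_continuous:
  assumes "integrable (intv L) v"
  shows "continuous_on UNIV (prim L v)"
  unfolding continuous_on_eq_continuous_at[OF open_UNIV] continuous_at_sequentially
proof (intro ballI allI impI)
  fix x and X :: "nat \<Rightarrow> real" assume X: "X \<longlonglongrightarrow> x"
  show "(prim L v \<circ> X) \<longlonglongrightarrow> prim L v x"
    unfolding prim_def comp_def
  proof (rule integral_dominated_convergence[where w = "\<lambda>t. \<bar>v t\<bar>"])
    \<comment> \<open>For \<open>t\<close> other than \<open>x\<close> the indicators are eventually
      constant; the point \<open>x\<close> itself is a null set.\<close>
    show "AE t in intv L. (\<lambda>i. indicator {..X i} t * v t) \<longlonglongrightarrow> indicator {..x} t * v t"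
      using AE_intv_neq[where x = x]
    proof eventually_elim
      case (elim t)
      have "\<forall>\<^sub>F i in sequentially. indicator {..X i} t = (indicator {..x} t :: real)"
      proof (cases "t < x")
        case True
        with order_tendstoD(1)[OF X True] show ?thesis by (auto elim!: eventually_mono simp: indicator_def)
      next
        case False
        with elim have "x < t" by simp
        with order_tendstoD(2)[OF X this] show ?thesis by (auto elim!: eventually_mono simp: indicator_def)
      qed
      then show ?case by (intro tendsto_mult tendsto_const tendsto_eventually)
    qed
  qed (use assms in \<open>auto intro!: borel_measurable_times borel_measurable_intv[of "indicator _"] simp: abs_mult mult_left_le_one_le\<close>)
qed

lemma prim_bound:
  assumes "integrable (intv L) v"
  shows "\<bar>prim L v x\<bar> \<le> (LINT t|intv L. \<bar>v t\<bar>)"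
proof -
  have "\<bar>prim L v x\<bar> \<le> (LINT t|intv L. \<bar>indicator {..x} t * v t\<bar>)"
    unfolding prim_def by (rule integral_abs_bound)
  also have "\<dots> \<le> (LINT t|intv L. \<bar>v t\<bar>)"
    by (intro integral_mono integrable_abs integrable_indicator_mult assms)
      (auto simp: indicator_def)
  finally show ?thesis .
qed

text \<open>Takes the place of a growth condition on \<open>\<phi>\<close>: a primitive ranges in a
  compact interval.\<close>

lemma comp_prim_bounded:
  fixes \<phi> :: "real \<Rightarrow> real"
  assumes "continuous_on UNIV \<phi>" "integrable (intv L) v"
  shows "\<exists>B. \<forall>t. \<bar>\<phi> (prim L v t)\<bar> \<le> B"
proof -
  have "compact (\<phi> ` cball 0 (LINT t|intv L. \<bar>v t\<bar>))"
    by (intro compact_continuous_image continuous_on_subset[OF assms(1)]) auto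
  from compact_imp_bounded[OF this] obtain B
    where "\<forall>y\<in>\<phi> ` cball 0 (LINT t|intv L. \<bar>v t\<bar>). \<bar>y\<bar> \<le> B"
    unfolding bounded_real by blast
  then show ?thesis using prim_bound[OF assms(2)] by (intro exI[of _ B]) auto
qed

lemma prim_FTC:
  assumes "\<And>x. (p has_real_derivative q x) (at x)" "continuous_on UNIV q" "0 \<le> x" "x \<le> L"
  shows "prim L q x = p x - p 0"
proof -
  have "prim L q x = (LINT t|lborel. indicator {0<..<L} t *\<^sub>R (indicator {..x} t * q t))"
    by (simp add: prim_def integral_restrict_space)
  also have "\<dots> = (LINT t|lborel. indicator {0..x} t *\<^sub>R q t)"
  proof (rule integral_cong_AE)
    show "AE t in lborel. indicator {0<..<L} t *\<^sub>R (indicator {..x} t * q t) = indicator {0..x} t *\<^sub>R q t"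
      using AE_lborel_singleton[of 0] AE_lborel_singleton[of L] AE_lborel_singleton[of x]
      by eventually_elim (use assms in \<open>auto simp: indicator_def\<close>)
  qed (use borel_measurable_continuous_onI[OF assms(2)] in auto)
  also have "\<dots> = p x - p 0"
    by (rule integral_FTC_atLeastAtMost)
      (use assms in \<open>auto intro: continuous_on_subset has_field_derivative_at_within
         simp: has_real_derivative_iff_has_vector_derivative[symmetric]\<close>)
  finally show ?thesis .
qed

text \<open>A function whose increments are dominated, locally uniformly and with arbitrarily small
  constant, by the increments of a fixed function has equal end values: sum over a fine partition.\<close>

lemma equal_ends_of_small_increments:
  fixes D V :: "real \<Rightarrow> real"
  assumes L: "0 < L"
    and inc: "\<And>e. 0 < e \<Longrightarrow> \<exists>d>0. \<forall>x y. 0 \<le> x \<longrightarrow> x \<le> y \<longrightarrow> y \<le> L \<longrightarrow> y - x < d \<longrightarrow>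
        \<bar>D y - D x\<bar> \<le> e * (V y - V x)"
  shows "D L = D 0"
proof -
  have *: "\<bar>D L - D 0\<bar> \<le> e * (V L - V 0)" if "0 < e" for e
  proof -
    obtain d where d: "0 < d" "\<And>x y. 0 \<le> x \<Longrightarrow> x \<le> y \<Longrightarrow> y \<le> L \<Longrightarrow> y - x < d \<Longrightarrow>
        \<bar>D y - D x\<bar> \<le> e * (V y - V x)" using inc[OF \<open>0 < e\<close>] by blast
    obtain n :: nat where n: "L / d < real n" using reals_Archimedean2 by blast
    then have n0: "0 < real n" using L d(1) by (smt (verit) divide_pos_pos)
    have nd: "L / real n < d" using n n0 d(1) by (simp add: field_simps)
    define X where "X i = real i * L / real n" for i :: nat
    have "\<bar>D (X (Suc i)) - D (X i)\<bar> \<le> e * (V (X (Suc i)) - V (X i))" if "i < n" for i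
    proof (rule d(2))
      show "0 \<le> X i" using L by (simp add: X_def)
      show "X i \<le> X (Suc i)" using L n0 by (simp add: X_def divide_right_mono)
      have "real (Suc i) * L \<le> real n * L" using that L by (intro mult_right_mono) auto
      then show "X (Suc i) \<le> L" using n0 by (simp add: X_def divide_le_eq mult.commute)
      have "X (Suc i) - X i = L / real n" by (simp add: X_def field_simps add_divide_distrib)
      then show "X (Suc i) - X i < d" using nd by simp
    qed
    then have "(\<Sum>i<n. \<bar>D (X (Suc i)) - D (X i)\<bar>) \<le> (\<Sum>i<n. e * (V (X (Suc i)) - V (X i)))"
      by (intro sum_mono) auto
    also have "\<dots> = e * (V (X n) - V (X 0))"
      by (simp add: sum_distrib_left[symmetric] sum_lessThan_telescope[of "\<lambda>i. V (X i)"])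
    finally have "\<bar>D (X n) - D (X 0)\<bar> \<le> e * (V (X n) - V (X 0))"
      using sum_abs[of "\<lambda>i. D (X (Suc i)) - D (X i)" "{..<n}"]
        sum_lessThan_telescope[of "\<lambda>i. D (X i)" n] by simp
    moreover have "X n = L" "X 0 = 0" using n0 by (auto simp: X_def)
    ultimately show ?thesis by simp
  qed
  have "\<bar>D L - D 0\<bar> \<le> 0"
  proof (rule field_le_epsilon)
    fix e :: real assume "0 < e"
    define c where "c = \<bar>V L - V 0\<bar> + 1"
    have c: "0 < c" by (simp add: c_def)
    have "\<bar>D L - D 0\<bar> \<le> (e / c) * (V L - V 0)" using c \<open>0 < e\<close> by (intro *) simp
    also have "\<dots> \<le> (e / c) * c" using c \<open>0 < e\<close> by (intro mult_left_mono) (auto simp: c_def)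
    finally show "\<bar>D L - D 0\<bar> \<le> 0 + e" using c by simp
  qed
  then show ?thesis by simp
qed

text \<open>The chain rule for an absolutely continuous function, in integrated form. On a short
  interval the mean value theorem turns the increment of P(w) into \<phi>(\<xi>) times the integral
  of v, and \<phi>(\<xi>) differs little from \<phi>(w(t)) by uniform continuity.\<close>

lemma integral_comp_prim_mult:
  assumes L: "0 < L" and v: "integrable (intv L) v" and \<phi>: "continuous_on UNIV \<phi>"
    and P: "\<And>x. (P has_real_derivative \<phi> x) (at x)"
  shows "(LINT t|intv L. \<phi> (prim L v t) * v t) = P (prim L v L) - P 0"
proof -
  let ?w = "prim L v"
  have cw: "continuous_on UNIV ?w" by (rule prim_continuous[OF v])
  define R where "R = (LINT t|intv L. \<bar>v t\<bar>)"
  have wR: "\<bar>?w x\<bar> \<le> R" for x unfolding R_def by (rule prim_bound[OF v])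
  have cc: "continuous_on UNIV (\<lambda>t. \<phi> (?w t))"
    using continuous_on_compose2[OF \<phi> cw] by simp
  have mc: "(\<lambda>t. \<phi> (?w t)) \<in> borel_measurable (intv L)"
    by (intro borel_measurable_intv borel_measurable_continuous_onI cc)
  have "compact (\<phi> ` {-R..R})"
    by (intro compact_continuous_image continuous_on_subset[OF \<phi>]) auto
  from compact_imp_bounded[OF this] obtain B where "\<forall>y\<in>\<phi> ` {-R..R}. \<bar>y\<bar> \<le> B"
    unfolding bounded_real by blast
  then have B: "\<bar>\<phi> s\<bar> \<le> B" if "s \<in> {-R..R}" for s using that by blast
  have B': "\<bar>\<phi> (?w t)\<bar> \<le> B" for t using wR[of t] by (intro B) auto
  have i1: "integrable (intv L) (\<lambda>t. \<phi> (?w t) * v t)"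
    by (rule integrable_bounded_mult[OF v mc]) (use B' in auto)
  \<comment> \<open>The increments of \<open>D\<close> are the errors of the chain rule, those of
    \<open>V\<close> the integrals of |v| against which the errors are measured.\<close>
  define D where "D x = P (?w x) - prim L (\<lambda>t. \<phi> (?w t) * v t) x" for x
  define V where "V = prim L (\<lambda>t. \<bar>v t\<bar>)"
  have "D L = D 0"
  proof (rule equal_ends_of_small_increments[OF L, of D V])
    fix e :: real assume "0 < e"
    have "uniformly_continuous_on {-R..R} \<phi>"
      by (intro compact_uniformly_continuous continuous_on_subset[OF \<phi>]) auto
    from uniformly_continuous_onE[OF this \<open>0 < e\<close>] obtain d1 where d1: "0 < d1" "\<And>s s'. s \<in> {-R..R} \<Longrightarrow> s' \<in> {-R..R} \<Longrightarrow> \<bar>s' - s\<bar> < d1 \<Longrightarrow> \<bar>\<phi> s' - \<phi> s\<bar> < e"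
      unfolding dist_real_def by blast
    have "uniformly_continuous_on {0..L} ?w"
      by (intro compact_uniformly_continuous continuous_on_subset[OF cw]) auto
    from uniformly_continuous_onE[OF this, of "d1 / 2"] \<open>0 < d1\<close> obtain d where d: "0 < d" "\<And>s s'. s \<in> {0..L} \<Longrightarrow> s' \<in> {0..L} \<Longrightarrow> \<bar>s' - s\<bar> < d \<Longrightarrow> \<bar>?w s' - ?w s\<bar> < d1 / 2"
      unfolding dist_real_def by auto
    show "\<exists>d>0. \<forall>x y. 0 \<le> x \<longrightarrow> x \<le> y \<longrightarrow> y \<le> L \<longrightarrow> y - x < d \<longrightarrow> \<bar>D y - D x\<bar> \<le> e * (V y - V x)"
    proof (intro exI conjI allI impI)
      fix x y assume xy: "0 \<le> x" "x \<le> y" "y \<le> L" "y - x < d"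
      \<comment> \<open>The intermediate value \<open>\<xi>\<close> lies between \<open>?w x\<close>
        and \<open>?w y\<close>. Its distance to \<open>?w t\<close> is at most the sum of two
        increments of \<open>?w\<close>, each below \<open>d1 / 2\<close>.\<close>
      obtain \<xi> where \<xi>: "P (?w y) - P (?w x) = \<phi> \<xi> * (?w y - ?w x)" "\<bar>\<xi> - ?w x\<bar> \<le> \<bar>?w y - ?w x\<bar>"
        "\<xi> \<in> {-R..R}"
      proof (cases "?w x" "?w y" rule: linorder_cases)
        case less
        from MVT2[OF less, of P \<phi>] P obtain z where "?w x < z" "z < ?w y"
          "P (?w y) - P (?w x) = (?w y - ?w x) * \<phi> z" by blast
        with wR[of x] wR[of y] show ?thesis by (intro that[of z]) auto
      next
        case equal
        with wR[of x] show ?thesis by (intro that[of "?w x"]) auto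
      next
        case greater
        from MVT2[OF greater, of P \<phi>] P obtain z where "?w y < z" "z < ?w x"
          "P (?w x) - P (?w y) = (?w x - ?w y) * \<phi> z" by blast
        with wR[of x] wR[of y] show ?thesis by (intro that[of z]) (auto simp: algebra_simps)
      qed
      have close: "\<bar>\<phi> \<xi> - \<phi> (?w t)\<bar> \<le> e" if "t \<in> {x<..y}" for t
      proof -
        have "\<bar>?w y - ?w x\<bar> < d1 / 2" "\<bar>?w t - ?w x\<bar> < d1 / 2"
          using d(2)[of x y] d(2)[of x t] that xy by auto
        then have "\<bar>\<xi> - ?w t\<bar> < d1" using \<xi>(2) by linarith
        moreover have "?w t \<in> {-R..R}" using wR[of t] by auto
          ultimately show ?thesis using d1(2)[of "?w t" \<xi>] \<xi>(3) by linarith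
      qed
      have "D y - D x = (LINT t|intv L. \<phi> \<xi> * (indicator {x<..y} t * v t))
          - (LINT t|intv L. indicator {x<..y} t * (\<phi> (?w t) * v t))"
        using \<xi>(1) prim_diff[OF i1 xy(2)] prim_diff[OF v xy(2)] by (simp add: D_def)
      also have "\<dots> = (LINT t|intv L. \<phi> \<xi> * (indicator {x<..y} t * v t) - indicator {x<..y} t * (\<phi> (?w t) * v t))"
        by (intro Bochner_Integration.integral_diff[symmetric] integrable_mult_right integrable_indicator_mult v i1) auto
      finally have "\<bar>D y - D x\<bar> \<le> (LINT t|intv L. \<bar>\<phi> \<xi> * (indicator {x<..y} t * v t) - indicator {x<..y} t * (\<phi> (?w t) * v t)\<bar>)"
        using integral_abs_bound[of "intv L" "\<lambda>t. \<phi> \<xi> * (indicator {x<..y} t * v t) - indicator {x<..y} t * (\<phi> (?w t) * v t)"]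
        by simp
      also have "\<dots> \<le> (LINT t|intv L. e * (indicator {x<..y} t * \<bar>v t\<bar>))"
      proof (intro integral_mono integrable_abs Bochner_Integration.integrable_diff integrable_mult_right integrable_indicator_mult v i1)
        fix t
        have "\<bar>\<phi> \<xi> - \<phi> (?w t)\<bar> * \<bar>v t\<bar> \<le> e * \<bar>v t\<bar>" if "t \<in> {x<..y}"
          by (intro mult_right_mono close that) auto
        then show "\<bar>\<phi> \<xi> * (indicator {x<..y} t * v t) - indicator {x<..y} t * (\<phi> (?w t) * v t)\<bar> \<le> e * (indicator {x<..y} t * \<bar>v t\<bar>)"
          by (auto simp: indicator_def abs_mult[symmetric] left_diff_distrib)
      qed auto
      also have "\<dots> = e * (V y - V x)"
        using prim_diff[of L "\<lambda>t. \<bar>v t\<bar>" x y] v xy(2) by (simp add: V_def)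
      finally show "\<bar>D y - D x\<bar> \<le> e * (V y - V x)" .
    qed (rule d(1))
  qed
  then show ?thesis by (simp add: D_def prim_L)
qed

lemma continuous_antiderivative:
  fixes \<phi> :: "real \<Rightarrow> real"
  assumes "continuous_on UNIV \<phi>"
  shows "\<exists>P. \<forall>x. (P has_real_derivative \<phi> x) (at x)"
  using einterval_antiderivative[of "-\<infinity>" "\<infinity>" \<phi>] assms
  by (auto simp: continuous_on_eq_continuous_at has_real_derivative_iff_has_vector_derivative)

text \<open>The antiderivative of \<open>\<phi>\<close> takes the same value at both ends, since the
  primitive vanishes there. This removes the nonlinear term from the energy estimate.\<close>

lemma integral_comp_prim_mult_eq_0:
  assumes "0 < L" "integrable (intv L) v" "continuous_on UNIV \<phi>" "(LINT t|intv L. v t) = 0"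
  shows "(LINT t|intv L. \<phi> (prim L v t) * v t) = 0"
  using integral_comp_prim_mult[OF assms(1-3)] continuous_antiderivative[OF assms(3)] assms(4)
  by (auto simp: prim_L)

lemma borel_measurable_prim:
  "integrable (intv L) v \<Longrightarrow> prim L v \<in> borel_measurable (intv L)"
  by (intro borel_measurable_intv borel_measurable_continuous_onI prim_continuous)

lemma integrable_prim_mult:
  assumes "integrable (intv L) v" "integrable (intv L) q"
  shows "integrable (intv L) (\<lambda>t. prim L v t * q t)"
  by (rule integrable_bounded_mult[OF assms(2) borel_measurable_prim[OF assms(1)]])
    (use prim_bound[OF assms(1)] in auto)

lemma L2_prim: "integrable (intv L) v \<Longrightarrow> L2 L (prim L v)"
  by (rule L2_bounded[OF borel_measurable_prim]) (use prim_bound in auto)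

text \<open>Polarization of the chain rule for the square.\<close>

lemma integral_prim_by_parts:
  assumes L: "0 < L" and v: "integrable (intv L) v" and q: "integrable (intv L) q"
  shows "(LINT t|intv L. prim L v t * q t) + (LINT t|intv L. v t * prim L q t) = prim L v L * prim L q L"
proof -
  have sq: "(LINT t|intv L. prim L f t * f t) = (prim L f L)\<^sup>2 / 2" if "integrable (intv L) f" for f
  proof -
    have "((\<lambda>s. s\<^sup>2 / 2) has_real_derivative s) (at s)" for s :: real
      by (auto intro!: derivative_eq_intros)
    from integral_comp_prim_mult[OF L that continuous_on_id this] show ?thesis by simp
  qed
  have add: "prim L (\<lambda>t. v t + q t) x = prim L v x + prim L q x" for x
    unfolding prim_def distrib_left
    by (intro Bochner_Integration.integral_add integrable_indicator_mult v q) auto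
  have "(LINT t|intv L. prim L (\<lambda>t. v t + q t) t * (v t + q t)) =
      (LINT t|intv L. (prim L v t * v t + prim L v t * q t) + (v t * prim L q t + prim L q t * q t))"
    unfolding add by (simp add: algebra_simps)
  also have "\<dots> = (LINT t|intv L. prim L v t * v t) + (LINT t|intv L. prim L v t * q t)
      + ((LINT t|intv L. v t * prim L q t) + (LINT t|intv L. prim L q t * q t))"
  proof -
    have "integrable (intv L) (\<lambda>t. v t * prim L q t)"
      using integrable_prim_mult[OF q v] by (simp only: mult.commute)
    then show ?thesis
      using integrable_prim_mult[OF v v] integrable_prim_mult[OF v q] integrable_prim_mult[OF q q]
      by simp
  qed
  finally show ?thesis
    using sq[OF v] sq[OF q] sq[OF Bochner_Integration.integrable_add[OF v q]]
    by (simp add: add power2_sum)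
qed

section \<open>Test functions, and primitives as elements of H^1_0\<close>

lemma test_fun_has_deriv:
  assumes "test_fun L \<psi>"
  shows "(\<psi> has_real_derivative deriv \<psi> x) (at x)"
proof -
  have "((deriv ^^ 0) \<psi>) differentiable (at x)" using assms unfolding test_fun_def by blast
  then show ?thesis by (simp add: DERIV_deriv_iff_real_differentiable)
qed

lemma test_fun_continuous_deriv:
  assumes "test_fun L \<psi>"
  shows "continuous_on UNIV (deriv \<psi>)"
proof -
  have "((deriv ^^ 1) \<psi>) differentiable (at x)" for x using assms unfolding test_fun_def by blast
  then show ?thesis
    by (auto simp: continuous_on_eq_continuous_at intro: differentiable_imp_continuous_within)
qed

lemma test_fun_zero: "test_fun L \<psi> \<Longrightarrow> \<psi> 0 = 0 \<and> \<psi> L = 0"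
  unfolding test_fun_def by force

lemma test_fun_prim:
  assumes "test_fun L \<psi>" "0 \<le> x" "x \<le> L"
  shows "prim L (deriv \<psi>) x = \<psi> x"
  using prim_FTC[OF test_fun_has_deriv[OF assms(1)] test_fun_continuous_deriv[OF assms(1)] assms(2,3)]
    test_fun_zero[OF assms(1)] by simp

lemma test_fun_deriv_bounded:
  assumes "test_fun L \<psi>"
  shows "\<exists>B. \<forall>x\<in>{0..L}. \<bar>deriv \<psi> x\<bar> \<le> B"
proof -
  have "compact (deriv \<psi> ` {0..L})"
    by (intro compact_continuous_image continuous_on_subset[OF test_fun_continuous_deriv[OF assms]]) auto
  from compact_imp_bounded[OF this] show ?thesis unfolding bounded_real by blast
qed

lemma borel_measurable_deriv_test_fun:
  "test_fun L \<psi> \<Longrightarrow> deriv \<psi> \<in> borel_measurable (intv L)"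
  by (intro borel_measurable_intv borel_measurable_continuous_onI test_fun_continuous_deriv)

lemma L2_deriv_test_fun:
  assumes "test_fun L \<psi>"
  shows "L2 L (deriv \<psi>)"
proof -
  obtain B where "\<forall>x\<in>{0..L}. \<bar>deriv \<psi> x\<bar> \<le> B" using test_fun_deriv_bounded[OF assms] by blast
  then show ?thesis
    by (intro L2_bounded[where B = B] borel_measurable_deriv_test_fun assms AE_I2) auto
qed

lemma integral_deriv_test_fun: "0 < L \<Longrightarrow> test_fun L \<psi> \<Longrightarrow> (LINT t|intv L. deriv \<psi> t) = 0"
  using test_fun_prim[of L \<psi> L] test_fun_zero[of L \<psi>] by (simp add: prim_L)

lemma weak_deriv_prim:
  assumes L: "0 < L" and v: "integrable (intv L) v" and u: "\<And>x. x \<in> {0<..<L} \<Longrightarrow> u x = prim L v x"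
  shows "weak_deriv L u v"
  unfolding weak_deriv_def set_lint_intv
proof (intro allI impI)
  fix \<psi> assume \<psi>: "test_fun L \<psi>"
  have "(LINT x|intv L. u x * deriv \<psi> x) = (LINT x|intv L. prim L v x * deriv \<psi> x)"
    by (intro Bochner_Integration.integral_cong) (auto simp: u)
  moreover have "(LINT x|intv L. v x * \<psi> x) = (LINT x|intv L. v x * prim L (deriv \<psi>) x)"
    by (intro Bochner_Integration.integral_cong) (auto simp: test_fun_prim[OF \<psi>])
  ultimately show "(LINT x|intv L. u x * deriv \<psi> x) = - (LINT x|intv L. v x * \<psi> x)"
    using integral_prim_by_parts[OF L v L2_integrable[OF L2_deriv_test_fun[OF \<psi>]]] L
    by (simp add: test_fun_prim[OF \<psi>] test_fun_zero[OF \<psi>])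
qed

text \<open>Mean zero of \<open>v\<close> is the boundary condition at \<open>L\<close>; the one at
  0 is built into \<open>prim\<close>.\<close>

lemma H10_of_prim:
  assumes L: "0 < L" and v: "L2 L v" "(LINT t|intv L. v t) = 0"
    and u: "\<And>x. x \<in> {0<..<L} \<Longrightarrow> u x = prim L v x"
  shows "H10 L u v"
proof -
  note iv = L2_integrable[OF v(1)]
  have "u \<in> borel_measurable (intv L) \<longleftrightarrow> prim L v \<in> borel_measurable (intv L)"
    by (rule measurable_cong) (simp add: u)
  moreover have "integrable (intv L) (\<lambda>x. (u x)\<^sup>2) \<longleftrightarrow> integrable (intv L) (\<lambda>x. (prim L v x)\<^sup>2)"
    by (rule Bochner_Integration.integrable_cong) (simp_all add: u)
  ultimately have "L2 L u" using L2_prim[OF iv] by (simp add: L2_intv)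
  moreover have "\<exists>w. continuous_on {0..L} w \<and> w 0 = 0 \<and> w L = 0 \<and>
          (AE x in lborel. x \<in> {0<..<L} \<longrightarrow> u x = w x)"
    using u v(2) by (intro exI[of _ "prim L v"])
      (auto simp: prim_L intro: continuous_on_subset[OF prim_continuous[OF iv]])
  ultimately show ?thesis
    using weak_deriv_prim[OF L iv u] v(1) by (simp add: H10_def)
qed

lemma H10_test_fun: "0 < L \<Longrightarrow> test_fun L \<psi> \<Longrightarrow> H10 L \<psi> (deriv \<psi>)"
  by (rule H10_of_prim) (auto simp: L2_deriv_test_fun integral_deriv_test_fun test_fun_prim)

section \<open>Mollified steps and the du Bois-Reymond lemma\<close>

text \<open>The classical function exp(-1/t), flat at 0, times a polynomial in 1/t. The polynomial
  parameter makes the family closed under differentiation.\<close>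

definition flat :: "real poly \<Rightarrow> real \<Rightarrow> real" where
  "flat p t = (if 0 < t then poly p (1 / t) * exp (- (1 / t)) else 0)"

lemma poly_mult_exp_tendsto_0: "((\<lambda>s. poly p s * exp (- s)) \<longlongrightarrow> (0 :: real)) at_top"
proof -
  have "((\<lambda>s. \<Sum>i\<le>degree p. coeff p i * (s ^ i / exp s)) \<longlongrightarrow> (\<Sum>i\<le>degree p. coeff p i * 0)) at_top"
    by (intro tendsto_sum tendsto_mult tendsto_const tendsto_power_div_exp_0)
  then show ?thesis by (simp add: poly_altdef sum_distrib_right exp_minus divide_inverse mult.assoc)
qed

lemma flat_tendsto_0: "(flat p \<longlongrightarrow> 0) (at 0)"
  unfolding filterlim_at_split
proof
  have "\<forall>\<^sub>F t in at_left 0. flat p t = 0" by (auto simp: eventually_at_filter flat_def)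
  then show "(flat p \<longlongrightarrow> 0) (at_left 0)" by (rule tendsto_eventually)
  have "((\<lambda>t. poly p (inverse t) * exp (- inverse t)) \<longlongrightarrow> 0) (at_right 0)"
    by (rule filterlim_compose[OF poly_mult_exp_tendsto_0 filterlim_inverse_at_top_right])
  moreover have "\<forall>\<^sub>F t in at_right 0. poly p (inverse t) * exp (- inverse t) = flat p t"
    by (auto simp: eventually_at_filter flat_def inverse_eq_divide)
  ultimately show "(flat p \<longlongrightarrow> 0) (at_right 0)"
    by (rule Lim_transform_eventually)
qed

text \<open>With s = 1/t one has ds/dt = -s^2, so p(s) exp(-s) has derivative s^2 (p(s) - p'(s))
  exp(-s). At 0 the difference quotient of \<open>flat p\<close> is itself a member of the family,
  with polynomial X p, and therefore tends to 0.\<close>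

lemma flat_has_deriv: "(flat p has_real_derivative flat ([:0, 0, 1:] * (p - pderiv p)) t) (at t)"
proof (cases t "0 :: real" rule: linorder_cases)
  case less
  have "((\<lambda>t. 0) has_real_derivative 0) (at t)" by simp
  then have "(flat p has_real_derivative 0) (at t)"
    by (rule DERIV_cong_ev[THEN iffD1, rotated -1, OF _ refl _ refl])
      (use order_tendstoD(2)[OF tendsto_ident_at less] less
        in \<open>auto simp: flat_def eventually_nhds intro!: exI[of _ "{..<0}"]\<close>)
  then show ?thesis using less by (simp add: flat_def)
next
  case equal
  have "((\<lambda>h. flat p h / h) \<longlongrightarrow> 0) (at 0)"
  proof (rule Lim_transform_eventually[OF flat_tendsto_0[of "[:0, 1:] * p"]])
    show "\<forall>\<^sub>F h in at 0. flat ([:0, 1:] * p) h = flat p h / h"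
      by (auto simp: eventually_at_filter flat_def)
  qed
  then show ?thesis using equal by (simp add: DERIV_def flat_def)
next
  case greater
  have "((\<lambda>t. poly p (1 / t) * exp (- (1 / t))) has_real_derivative
      poly (pderiv p) (1 / t) * (- (1 / t\<^sup>2)) * exp (- (1 / t))
        + poly p (1 / t) * (exp (- (1 / t)) * (1 / t\<^sup>2))) (at t)"
    using greater
    by (auto intro!: derivative_eq_intros DERIV_chain2[OF poly_DERIV] simp: power2_eq_square)
  then have "(flat p has_real_derivative poly (pderiv p) (1 / t) * (- (1 / t\<^sup>2)) * exp (- (1 / t))
        + poly p (1 / t) * (exp (- (1 / t)) * (1 / t\<^sup>2))) (at t)"
    by (rule DERIV_cong_ev[THEN iffD1, rotated -1, OF _ refl _ refl])
      (use greater in \<open>auto simp: flat_def eventually_nhds intro!: exI[of _ "{0<..}"]\<close>)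
  moreover have "poly (pderiv p) (1 / t) * (- (1 / t\<^sup>2)) * exp (- (1 / t))
        + poly p (1 / t) * (exp (- (1 / t)) * (1 / t\<^sup>2)) = flat ([:0, 0, 1:] * (p - pderiv p)) t"
    using greater by (simp add: flat_def field_simps power2_eq_square)
  ultimately show ?thesis by simp
qed

text \<open>A class of functions closed under differentiation, rich enough to contain mollified steps.\<close>

inductive mollified :: "(real \<Rightarrow> real) \<Rightarrow> bool" where
  bump: "mollified (\<lambda>t. flat p t * flat q (1 - t))"
| add: "mollified f \<Longrightarrow> mollified g \<Longrightarrow> mollified (\<lambda>t. f t + g t)"
| affine: "mollified f \<Longrightarrow> mollified (\<lambda>t. a * f (c * t + d))"
| antiderivative: "mollified f \<Longrightarrow> (\<And>x. (h has_real_derivative f x) (at x)) \<Longrightarrow> mollified h"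

lemma mollified_has_deriv: "mollified f \<Longrightarrow> \<exists>g. mollified g \<and> (\<forall>x. (f has_real_derivative g x) (at x))"
proof (induction rule: mollified.induct)
  case (bump p q)
  let ?D = "\<lambda>p. [:0, 0, 1:] * (p - pderiv p)"
  \<comment> \<open>The class has no rule for differences: the second summand is written with factor
    -1 and argument \<open>1 * t + 0\<close> to fit the rule \<open>affine\<close>.\<close>
  have "((\<lambda>t. flat p t * flat q (1 - t)) has_real_derivative
      flat (?D p) t * flat q (1 - t) + (-1) * (flat p (1 * t + 0) * flat (?D q) (1 - (1 * t + 0)))) (at t)" for t
    by (auto intro!: derivative_eq_intros DERIV_chain2[OF flat_has_deriv] flat_has_deriv)
  moreover have "mollified (\<lambda>t. flat (?D p) t * flat q (1 - t) + (-1) * (flat p (1 * t + 0) * flat (?D q) (1 - (1 * t + 0))))"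
    by (intro mollified.add mollified.affine[where f = "\<lambda>t. flat p t * flat (?D q) (1 - t)"] mollified.bump)
  ultimately show ?case by blast
next
  case (add f g)
  then obtain f' g' where *: "mollified f'" "\<And>x. (f has_real_derivative f' x) (at x)"
    "mollified g'" "\<And>x. (g has_real_derivative g' x) (at x)" by blast
  then have "mollified (\<lambda>t. f' t + g' t)" by (intro mollified.add)
  with * show ?case by (blast intro: DERIV_add)
next
  case (affine f a c d)
  then obtain f' where *: "mollified f'" "\<And>x. (f has_real_derivative f' x) (at x)" by blast
  have "((\<lambda>t. a * f (c * t + d)) has_real_derivative (a * c) * f' (c * x + d)) (at x)" for x
    by (auto intro!: derivative_eq_intros DERIV_chain2[OF *(2)])
  with mollified.affine[OF *(1), of "a * c" c d] show ?case by blast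
qed blast

lemma mollified_deriv:
  assumes "mollified f"
  shows "mollified (deriv f)" "f differentiable (at x)"
proof -
  obtain g where g: "mollified g" "\<And>x. (f has_real_derivative g x) (at x)"
    using mollified_has_deriv[OF assms] by blast
  then have "deriv f = g" using DERIV_imp_deriv by blast
  with g show "mollified (deriv f)" "f differentiable (at x)"
    by (auto simp: real_differentiable_def)
qed

lemma mollified_smooth: "mollified f \<Longrightarrow> ((deriv ^^ k) f) differentiable (at x)"
proof -
  assume "mollified f"
  then have "mollified ((deriv ^^ k) f)" by (induction k) (auto intro: mollified_deriv)
  then show ?thesis by (rule mollified_deriv)
qed

text \<open>\<open>b\<close> is the bump exp(-1/t) exp(-1/(1-t)) on (0,1) divided by its integral.
  \<open>S\<close> is available only as an antiderivative of it, which is the purpose of the rule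
  \<open>antiderivative\<close>.\<close>

lemma ex_mollified_step:
  obtains S b where "mollified S" "\<And>t. (S has_real_derivative b t) (at t)" "continuous_on UNIV b"
    "\<And>t. 0 \<le> b t" "\<And>t. t \<notin> {0..1} \<Longrightarrow> b t = 0" "\<And>t. t \<le> 0 \<Longrightarrow> S t = 0" "\<And>t. 1 \<le> t \<Longrightarrow> S t = 1"
proof -
  define b where "b t = flat 1 t * flat 1 (1 - t)" for t
  have mb: "mollified b" using mollified.bump[of 1 1] by (simp add: b_def[abs_def])
  have cb: "continuous_on UNIV b"
    using mollified_deriv(2)[OF mb]
    by (auto simp: continuous_on_eq_continuous_at intro: differentiable_imp_continuous_within)
  have b0: "0 \<le> b t" for t by (auto simp: b_def flat_def)
  have b1: "b t = 0" if "t \<le> 0 \<or> 1 \<le> t" for t using that by (auto simp: b_def flat_def)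
  have bpos: "0 < b t" if "0 < t" "t < 1" for t using that by (auto simp: b_def flat_def)
  obtain P where P: "\<And>x. (P has_real_derivative b x) (at x)"
    using continuous_antiderivative[OF cb] by blast
  have cP: "continuous_on A P" for A
    by (intro continuous_at_imp_continuous_on ballI DERIV_isCont[OF P])
  have "P 0 < P 1"
  proof (rule DERIV_pos_imp_increasing_open[where f = P])
    show "\<exists>y. (P has_real_derivative y) (at x) \<and> 0 < y" if "0 < x" "x < 1" for x
      using P[of x] bpos[OF that] by (intro exI[of _ "b x"] conjI)
    show "continuous_on {0..1} P" by (rule cP)
  qed simp
  \<comment> \<open>The integral of the unnormalised bump; it is positive because the bump is
    positive inside (0,1).\<close>
  define c where "c = P 1 - P 0"
  have c: "0 < c" using \<open>P 0 < P 1\<close> by (simp add: c_def)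
  have Pl: "P t = P 0" if "t \<le> 0" for t
  proof (cases "t = 0")
    case False
    with that have "t < 0" by simp
    from MVT2[OF this, of P b] P obtain z where "t < z" "z < 0" "P 0 - P t = (0 - t) * b z" by blast
    then show ?thesis using b1[of z] by simp
  qed simp
  have Pr: "P t = P 1" if "1 \<le> t" for t
  proof (cases "t = 1")
    case False
    with that have "1 < t" by simp
    from MVT2[OF this, of P b] P obtain z where "1 < z" "z < t" "P t - P 1 = (t - 1) * b z" by blast
    then show ?thesis using b1[of z] by simp
  qed simp
  show ?thesis
  proof
    show d: "((\<lambda>t. (P t - P 0) / c) has_real_derivative b t / c) (at t)" for t
      using c by (auto intro!: derivative_eq_intros P)
    have "mollified (\<lambda>t. (1 / c) * b (1 * t + 0))" by (rule mollified.affine[OF mb])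
    then have "mollified (\<lambda>t. b t / c)" by simp
    then show "mollified (\<lambda>t. (P t - P 0) / c)" using d by (rule mollified.antiderivative)
    show "continuous_on UNIV (\<lambda>t. b t / c)" using c by (intro continuous_intros cb) auto
    show "(P t - P 0) / c = 0" if "t \<le> 0" for t using Pl[OF that] by simp
    show "(P t - P 0) / c = 1" if "1 \<le> t" for t using Pr[OF that] c by (simp add: c_def)
  qed (use b0 b1 c in auto)
qed

lemma borel_measurable_intv_continuous_on:
  fixes f :: "real \<Rightarrow> real"
  assumes "continuous_on {0<..<L} f"
  shows "f \<in> borel_measurable (intv L)"
proof -
  have "f \<in> borel_measurable (restrict_space borel {0<..<L})"
    by (rule borel_measurable_continuous_on_restrict[OF assms])
  then show ?thesis
    by (simp cong: measurable_cong_sets add: sets_restrict_space)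
qed

text \<open>A continuous form of the du Bois-Reymond lemma: test against a mollification of the
  indicator of an interval.\<close>

lemma continuous_weakly_const:
  fixes q :: "real \<Rightarrow> real"
  assumes q: "continuous_on {0..L} q"
    and test: "\<And>\<psi>. test_fun L \<psi> \<Longrightarrow> (LINT t|intv L. q t * deriv \<psi> t) = 0"
    and xy: "0 < x" "x < L" "0 < y" "y < L"
  shows "q x = q y"
proof -
  obtain S b where Sb: "mollified S" "\<And>t. (S has_real_derivative b t) (at t)" "continuous_on UNIV b"
    "\<And>t. 0 \<le> b t" "\<And>t. t \<notin> {0..1} \<Longrightarrow> b t = 0" "\<And>t. t \<le> 0 \<Longrightarrow> S t = 0" "\<And>t. 1 \<le> t \<Longrightarrow> S t = 1"
    by (rule ex_mollified_step) blast
  have mq: "q \<in> borel_measurable (intv L)"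
    by (intro borel_measurable_intv_continuous_on continuous_on_subset[OF q]) auto
  have "compact (q ` {0..L})" by (intro compact_continuous_image q) auto
  from compact_imp_bounded[OF this] obtain Q where Q: "\<And>t. t \<in> {0..L} \<Longrightarrow> \<bar>q t\<bar> \<le> Q"
    unfolding bounded_real by blast
  \<comment> \<open>An approximate identity concentrated on [z, z + h], the derivative of a step
    rescaled to that interval. For z + h < L its integral is one, so the averages of
    \<open>q\<close> against it tend to \<open>q z\<close> as h tends to 0.\<close>
  define \<beta> where "\<beta> h z t = b ((t - z) / h) / h" for h z t
  have c\<beta>: "continuous_on UNIV (\<beta> h z)" if "0 < h" for h z
    unfolding \<beta>_def using that by (intro continuous_intros continuous_on_compose2[OF Sb(3)]) auto
  have d\<beta>: "((\<lambda>t. S ((t - z) / h)) has_real_derivative \<beta> h z t) (at t)" if "0 < h" for h z t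
  proof -
    have "((\<lambda>t. (t - z) / h) has_real_derivative 1 / h) (at t)"
      using that by (auto intro!: derivative_eq_intros)
    from DERIV_chain2[OF Sb(2) this] show ?thesis by (simp add: \<beta>_def)
  qed
  have i\<beta>: "integrable (intv L) (\<beta> h z)" if "0 < h" for h z
  proof -
    have "compact (\<beta> h z ` {0..L})"
      by (intro compact_continuous_image continuous_on_subset[OF c\<beta>[OF that]]) auto
    from compact_imp_bounded[OF this] obtain B where B: "\<And>t. t \<in> {0..L} \<Longrightarrow> \<bar>\<beta> h z t\<bar> \<le> B"
      unfolding bounded_real by blast
    show ?thesis
      by (rule integrable_intv_bounded[where B = B])
        (use B in \<open>auto intro!: borel_measurable_intv borel_measurable_continuous_onI c\<beta>[OF that]\<close>)
  qed
  have iq\<beta>: "integrable (intv L) (\<lambda>t. q t * \<beta> h z t)" if "0 < h" for h z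
    by (rule integrable_bounded_mult[OF i\<beta>[OF that] mq, where B = Q]) (use Q in auto)
  have one: "(LINT t|intv L. \<beta> h z t) = 1" if "0 < h" "0 < z" "z + h < L" for h z
    using prim_FTC[of "\<lambda>t. S ((t - z) / h)" "\<beta> h z", OF d\<beta>[OF that(1)] c\<beta>[OF that(1)], of L L] that
    by (simp add: prim_L Sb(6,7) divide_nonpos_pos)
  have mol: "\<exists>d>0. \<forall>h. 0 < h \<longrightarrow> h < d \<longrightarrow> \<bar>(LINT t|intv L. q t * \<beta> h z t) - q z\<bar> \<le> e"
    if z: "0 < z" "z < L" and e: "0 < e" for z e
  proof -
    have "z \<in> {0..L}" using z by simp
    with q e obtain d where d: "0 < d" "\<And>t. t \<in> {0..L} \<Longrightarrow> \<bar>t - z\<bar> < d \<Longrightarrow> \<bar>q t - q z\<bar> < e"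
      unfolding continuous_on_iff dist_real_def by blast
    have "\<bar>(LINT t|intv L. q t * \<beta> h z t) - q z\<bar> \<le> e" if h: "0 < h" "h < min d (L - z)" for h
    proof -
      have "(LINT t|intv L. q t * \<beta> h z t) - q z = (LINT t|intv L. q t * \<beta> h z t - q z * \<beta> h z t)"
        using one[of h z] h z iq\<beta>[of h z] i\<beta>[of h z] by simp
      also have "\<bar>\<dots>\<bar> \<le> (LINT t|intv L. e * \<beta> h z t)"
      proof (rule order_trans[OF integral_abs_bound integral_mono])
        fix t assume "t \<in> space (intv L)"
        then have t: "t \<in> {0..L}" by simp
        show "\<bar>q t * \<beta> h z t - q z * \<beta> h z t\<bar> \<le> e * \<beta> h z t"
        proof (cases "(t - z) / h \<in> {0..1}")
          case True
          then have "\<bar>t - z\<bar> < d" using h by (auto simp: field_simps)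
          then have "\<bar>q t - q z\<bar> \<le> e" using d(2)[OF t] by simp
          moreover have "0 \<le> \<beta> h z t" using Sb(4) h by (simp add: \<beta>_def)
          ultimately show ?thesis by (simp add: left_diff_distrib[symmetric] abs_mult mult_right_mono)
        next
          case False
          then show ?thesis using Sb(5) by (simp add: \<beta>_def)
        qed
      qed (use iq\<beta>[of h z] i\<beta>[of h z] h in auto)
      also have "\<dots> = e" using one[of h z] h z by simp
      finally show ?thesis .
    qed
    then show ?thesis using d(1) z by (intro exI[of _ "min d (L - z)"]) auto
  qed
  have "\<bar>q x - q y\<bar> \<le> 0"
  proof (rule field_le_epsilon)
    fix e :: real assume "0 < e"
    then have e2: "0 < e / 2" by simp
    obtain d1 where d1: "0 < d1" "\<And>h. 0 < h \<Longrightarrow> h < d1 \<Longrightarrow> \<bar>(LINT t|intv L. q t * \<beta> h x t) - q x\<bar> \<le> e / 2"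
      using mol[OF xy(1,2) e2] by blast
    obtain d2 where d2: "0 < d2" "\<And>h. 0 < h \<Longrightarrow> h < d2 \<Longrightarrow> \<bar>(LINT t|intv L. q t * \<beta> h y t) - q y\<bar> \<le> e / 2"
      using mol[OF xy(3,4) e2] by blast
    define m where "m = min (min d1 d2) (min (L - x) (L - y))"
    have m: "0 < m" "m \<le> d1" "m \<le> d2" "m \<le> L - x" "m \<le> L - y"
      using d1(1) d2(1) xy by (auto simp: m_def)
    define h where "h = m / 2"
    have h: "0 < h" "h < d1" "h < d2" "x + h < L" "y + h < L"
      using m unfolding h_def by linarith+
    \<comment> \<open>Difference of two steps rising on [x, x + h] and [y, y + h]: both are 0 before
      and 1 after, so it has compact support in the interval, and its derivative is the difference
      of two mollifiers. The spelling fits the rules \<open>add\<close> and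
      \<open>affine\<close>.\<close>
    define \<psi> where "\<psi> t = 1 * S ((1 / h) * t + (- x / h)) + (- 1) * S ((1 / h) * t + (- y / h))" for t
    have \<psi>: "\<psi> t = S ((t - x) / h) - S ((t - y) / h)" for t
      by (simp add: \<psi>_def diff_divide_distrib)
    have "mollified \<psi>" unfolding \<psi>_def[abs_def]
      by (intro mollified.add mollified.affine Sb(1))
    then have "\<forall>k t. ((deriv ^^ k) \<psi>) differentiable (at t)" using mollified_smooth by blast
    moreover have "\<psi> t = 0" if "t \<notin> {min x y..max x y + h}" for t
    proof (cases "t < min x y")
      case True
      then show ?thesis using h(1) by (simp add: \<psi> Sb(6) divide_nonpos_pos)
    next
      case False
      then have "h \<le> t - x" "h \<le> t - y" using that by auto
      then show ?thesis using h(1) by (simp add: \<psi> Sb(7))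
    qed
    ultimately have "test_fun L \<psi>"
      unfolding test_fun_def using xy h
      by (intro conjI exI[of _ "min x y"] exI[of _ "max x y + h"]) auto
    then have "(LINT t|intv L. q t * deriv \<psi> t) = 0" by (rule test)
    moreover have "deriv \<psi> t = \<beta> h x t - \<beta> h y t" for t
      unfolding \<psi>[abs_def] by (intro DERIV_imp_deriv DERIV_diff d\<beta> h)
    ultimately have "(LINT t|intv L. q t * \<beta> h x t) = (LINT t|intv L. q t * \<beta> h y t)"
      using iq\<beta>[OF h(1)] by (simp add: right_diff_distrib)
    then show "\<bar>q x - q y\<bar> \<le> 0 + e" using d1(2)[OF h(1,2)] d2(2)[OF h(1,3)] by linarith
  qed
  then show ?thesis by simp
qed

section \<open>Functions of H^1_0 as primitives\<close>

text \<open>The continuous representative \<open>w\<close> minus the primitive of \<open>du\<close>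
  has weak derivative zero, hence is constant by du Bois-Reymond. The value of \<open>w\<close> at 0
  makes the constant 0, and its value at \<open>L\<close> then makes the mean of \<open>du\<close>
  zero.\<close>

lemma H10_prim:
  assumes L: "0 < L" and H: "H10 L u du"
  shows "AE x in intv L. u x = prim L du x" "(LINT t|intv L. du t) = 0"
proof -
  obtain w where w: "continuous_on {0..L} w" "w 0 = 0" "w L = 0" "AE x in intv L. u x = w x"
    using H unfolding H10_def AE_intv by blast
  have du: "L2 L du" "L2 L u" using H by (auto simp: H10_def)
  note idu = L2_integrable[OF du(1)]
  define q where "q x = w x - prim L du x" for x
  have cq: "continuous_on {0..L} q" unfolding q_def
    by (intro continuous_intros w(1) continuous_on_subset[OF prim_continuous[OF idu]]) auto
  have mw: "w \<in> borel_measurable (intv L)"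
    by (intro borel_measurable_intv_continuous_on continuous_on_subset[OF w(1)]) auto
  have eq: "q x = q y" if "0 < x" "x < L" "0 < y" "y < L" for x y
  proof (rule continuous_weakly_const[OF cq _ that])
    fix \<psi> assume \<psi>: "test_fun L \<psi>"
    note L2\<psi> = L2_deriv_test_fun[OF \<psi>]
    have "(LINT t|intv L. w t * deriv \<psi> t) = (LINT t|intv L. u t * deriv \<psi> t)"
      by (rule integral_cong_AE)
        (use w(4) mw du(2) L2\<psi> in \<open>auto simp: L2_intv elim!: eventually_mono intro!: borel_measurable_times\<close>)
    also have "\<dots> = - (LINT t|intv L. du t * \<psi> t)"
      using H \<psi> by (simp add: H10_def weak_deriv_def set_lint_intv)
    also have "\<dots> = (LINT t|intv L. prim L du t * deriv \<psi> t)"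
      using weak_deriv_prim[OF L idu, of "prim L du"] \<psi> by (simp add: weak_deriv_def set_lint_intv)
    finally have "(LINT t|intv L. w t * deriv \<psi> t) = (LINT t|intv L. prim L du t * deriv \<psi> t)" .
    moreover have "integrable (intv L) (\<lambda>t. w t * deriv \<psi> t)"
    proof -
      have "integrable (intv L) (\<lambda>t. w t * deriv \<psi> t) \<longleftrightarrow> integrable (intv L) (\<lambda>t. u t * deriv \<psi> t)"
        by (rule integrable_cong_AE)
          (use w(4) mw du(2) L2\<psi> in \<open>auto simp: L2_intv elim!: eventually_mono intro!: borel_measurable_times\<close>)
      then show ?thesis using L2_mult_integrable[OF du(2) L2\<psi>] by simp
    qed
    ultimately show "(LINT t|intv L. q t * deriv \<psi> t) = 0"
      using integrable_prim_mult[OF idu L2_integrable[OF L2\<psi>]] by (simp add: q_def left_diff_distrib)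
  qed
  define c where "c = q (L / 2)"
  have qc: "q x = c" if "x \<in> {0..L}" for x
  proof (rule continuous_constant_on_closure[of "{0<..<L}" q c])
    show "continuous_on (closure {0<..<L}) q" using cq L by simp
    show "q x = c" if "x \<in> {0<..<L}" for x
      unfolding c_def using that L by (intro eq) auto
  qed (use that L in auto)
  have "q 0 = 0" using w(2) by (simp add: q_def)
  then have q0: "q x = 0" if "x \<in> {0..L}" for x using qc[OF that] qc[of 0] L by simp
  show "AE x in intv L. u x = prim L du x"
    using w(4) AE_space
  proof eventually_elim
    case (elim x)
    then show ?case using q0[of x] by (simp add: q_def)
  qed
  show "(LINT t|intv L. du t) = 0" using q0[of L] w(3) L by (simp add: q_def prim_L)
qed

section \<open>Solvability for continuous nonlinearities\<close>

text \<open>With \<open>\<phi>\<close> bounded, the slopes have an integrable majorant that does not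
  depend on the unknown function.\<close>

locale bounded_problem =
  fixes L \<alpha> \<beta> B :: real and a g \<phi> :: "real \<Rightarrow> real"
  assumes L: "0 < L" and \<alpha>: "0 < \<alpha>"
    and a: "a \<in> borel_measurable (intv L)" "AE t in intv L. \<alpha> \<le> a t \<and> a t \<le> \<beta>"
    and g: "integrable (intv L) g"
    and \<phi>: "continuous_on UNIV \<phi>" "\<And>s. \<bar>\<phi> s\<bar> \<le> B"
begin

text \<open>The integrated equation solved for u'. The function \<open>w\<close> inside the
  nonlinearity is kept separate from the unknown, so that a delayed function can be
  inserted.\<close>

definition rhs :: "(real \<Rightarrow> real) \<Rightarrow> real \<Rightarrow> real \<Rightarrow> real" where
  "rhs w C t = (\<phi> (w t) + g t + C) / a t"

definition majorant :: "real \<Rightarrow> real \<Rightarrow> real" where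
  "majorant K t = (B + \<bar>g t\<bar> + K) / \<alpha>"

lemma borel_measurable_rhs:
  assumes "w \<in> borel_measurable (intv L)"
  shows "rhs w C \<in> borel_measurable (intv L)"
proof -
  have "(\<lambda>t. \<phi> (w t)) \<in> borel_measurable (intv L)"
    by (rule measurable_compose[OF assms borel_measurable_continuous_onI[OF \<phi>(1)]])
  then show ?thesis unfolding rhs_def[abs_def]
    using a(1) borel_measurable_integrable[OF g]
    by (intro borel_measurable_divide borel_measurable_add) auto
qed

lemma integrable_majorant: "integrable (intv L) (majorant K)"
  unfolding majorant_def[abs_def] using g by simp

lemma rhs_le_majorant:
  assumes "\<bar>C\<bar> \<le> K"
  shows "AE t in intv L. \<bar>rhs w C t\<bar> \<le> majorant K t"
  using a(2)
proof eventually_elim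
  case (elim t)
  have "\<bar>\<phi> (w t) + g t + C\<bar> \<le> B + \<bar>g t\<bar> + K"
    using \<phi>(2)[of "w t"] assms by linarith
  then show ?case
    using elim \<alpha> unfolding rhs_def majorant_def abs_divide by (intro frac_le) auto
qed

lemma integrable_rhs: "w \<in> borel_measurable (intv L) \<Longrightarrow> integrable (intv L) (rhs w C)"
  by (rule Bochner_Integration.integrable_bound[OF integrable_majorant[of "\<bar>C\<bar>"] borel_measurable_rhs])
    (use rhs_le_majorant[of C "\<bar>C\<bar>" w] in \<open>auto elim!: eventually_mono\<close>)

lemma rhs_tendsto:
  assumes "(\<lambda>i. w i t) \<longlonglongrightarrow> w' t" "C \<longlonglongrightarrow> C'"
  shows "(\<lambda>i. rhs (w i) (C i) t) \<longlonglongrightarrow> rhs w' C' t"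
proof -
  have "isCont \<phi> (w' t)" using \<phi>(1) by (simp add: continuous_on_eq_continuous_at)
  then have "(\<lambda>i. \<phi> (w i t)) \<longlonglongrightarrow> \<phi> (w' t)" using assms(1) by (rule isCont_tendsto_compose)
  then show ?thesis unfolding rhs_def divide_inverse
    by (intro tendsto_intros assms(2))
qed

text \<open>Serves twice: for the dependence of the delayed solutions on \<open>C\<close>, and for
  the limit of vanishing delay. Convergent constants are bounded, so one majorant dominates the
  whole sequence.\<close>

lemma prim_rhs_tendsto:
  assumes w: "\<And>i. w i \<in> borel_measurable (intv L)" "w' \<in> borel_measurable (intv L)"
    and lim: "\<And>t. t \<in> {0<..<L} \<Longrightarrow> (\<lambda>i. w i t) \<longlonglongrightarrow> w' t" "C \<longlonglongrightarrow> C'"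
  shows "(\<lambda>i. prim L (rhs (w i) (C i)) x) \<longlonglongrightarrow> prim L (rhs w' C') x"
proof -
  obtain K where K: "\<And>i. \<bar>C i\<bar> \<le> K"
    using convergent_imp_bounded[OF lim(2)] unfolding bounded_real by blast
  show ?thesis unfolding prim_def
  proof (rule integral_dominated_convergence[where w = "majorant K"])
    show "AE t in intv L. (\<lambda>i. indicator {..x} t * rhs (w i) (C i) t) \<longlonglongrightarrow> indicator {..x} t * rhs w' C' t"
      by (intro AE_I2 tendsto_mult tendsto_const rhs_tendsto lim) simp
    show "AE t in intv L. norm (indicator {..x} t * rhs (w i) (C i) t) \<le> majorant K t" for i
      using rhs_le_majorant[OF K[of i], of "w i"]
      by eventually_elim (auto simp: indicator_def)
  qed (auto intro!: borel_measurable_times borel_measurable_rhs w integrable_majorant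
      borel_measurable_intv[of "indicator _"])
qed

text \<open>Tonelli's scheme: with a delay h the equation is solved explicitly, one time step
  after the other.\<close>

primrec tonelli :: "real \<Rightarrow> real \<Rightarrow> nat \<Rightarrow> real \<Rightarrow> real" where
  "tonelli h C 0 = (\<lambda>x. 0)"
| "tonelli h C (Suc n) = prim L (rhs (\<lambda>t. tonelli h C n (t - h)) C)"

lemma tonelli_continuous: "continuous_on UNIV (tonelli h C n)"
proof (induction n)
  case (Suc n)
  have "continuous_on UNIV (\<lambda>t. tonelli h C n (t - h))"
    by (rule continuous_on_compose2[OF Suc.IH]) (auto intro: continuous_intros)
  then have "integrable (intv L) (rhs (\<lambda>t. tonelli h C n (t - h)) C)"
    by (intro integrable_rhs borel_measurable_intv borel_measurable_continuous_onI)
  then show ?case by (simp add: prim_continuous)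
qed simp

lemma borel_measurable_tonelli: "(\<lambda>t. tonelli h C n (t - h)) \<in> borel_measurable (intv L)"
  by (intro borel_measurable_intv borel_measurable_continuous_onI
      continuous_on_compose2[OF tonelli_continuous]) (auto intro: continuous_intros)

text \<open>The values of a stage up to \<open>x\<close> depend on the previous stage only up to
  \<open>x - h\<close>. Each stage thus settles one more interval of length \<open>h\<close>, and
  once the stages cover the interval the iterate solves the delayed equation.\<close>

lemma tonelli_stable: "x \<le> real n * h \<Longrightarrow> tonelli h C (Suc n) x = tonelli h C n x"
proof (induction n arbitrary: x)
  case 0
  then show ?case by (simp add: prim_nonpos)
next
  case (Suc n)
  have "indicator {..x} t * rhs (\<lambda>t. tonelli h C (Suc n) (t - h)) C t
      = indicator {..x} t * rhs (\<lambda>t. tonelli h C n (t - h)) C t" for t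
  proof (cases "t \<le> x")
    case True
    then have "t - h \<le> real n * h" using Suc.prems by (simp add: algebra_simps)
    then show ?thesis using Suc.IH[of "t - h"] by (simp add: rhs_def del: tonelli.simps)
  qed simp
  then have "prim L (rhs (\<lambda>t. tonelli h C (Suc n) (t - h)) C) x = prim L (rhs (\<lambda>t. tonelli h C n (t - h)) C) x"
    unfolding prim_def by (simp only:)
  then show ?case by simp
qed

lemma tonelli_tendsto: "C \<longlonglongrightarrow> C' \<Longrightarrow> (\<lambda>i. tonelli h (C i) n x) \<longlonglongrightarrow> tonelli h C' n x"
proof (induction n arbitrary: x)
  case (Suc n)
  show ?case unfolding tonelli.simps
    by (rule prim_rhs_tendsto[OF borel_measurable_tonelli borel_measurable_tonelli Suc.IH[OF Suc.prems] Suc.prems])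
qed simp

text \<open>The least C for which the lower bound (C - B) / \<beta> - |g| / \<alpha> of the slope
  has nonnegative integral. Hence u(L) is nonnegative for C = Cmax and nonpositive for C = -Cmax,
  which brackets a zero.\<close>

definition Cmax :: real where
  "Cmax = B + \<beta> / (\<alpha> * L) * (LINT t|intv L. \<bar>g t\<bar>)"

lemma alpha_le_beta: "\<alpha> \<le> \<beta>"
proof -
  have "(LINT t|intv L. \<alpha>) \<le> (LINT t|intv L. \<beta>)"
  proof (rule integral_mono_AE)
    show "AE t in intv L. \<alpha> \<le> \<beta>" using a(2) by eventually_elim linarith
  qed auto
  then show ?thesis using L by (simp add: measure_intv)
qed

lemma Cmax: "B \<le> Cmax"
  using \<alpha> L alpha_le_beta by (simp add: Cmax_def)

lemma B_nonneg: "0 \<le> B"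
  using \<phi>(2)[of 0] by linarith

lemma integral_rhs_sign:
  assumes w: "w \<in> borel_measurable (intv L)"
  shows "0 \<le> (LINT t|intv L. rhs w Cmax t)" "(LINT t|intv L. rhs w (- Cmax) t) \<le> 0"
proof -
  have i: "integrable (intv L) (\<lambda>t. (Cmax - B) / \<beta> - \<bar>g t\<bar> / \<alpha>)" using g by simp
  have "(LINT t|intv L. (Cmax - B) / \<beta> - \<bar>g t\<bar> / \<alpha>) = (Cmax - B) / \<beta> * L - (LINT t|intv L. \<bar>g t\<bar>) / \<alpha>"
    using g L by (simp add: measure_intv)
  also have "\<dots> = 0" using \<alpha> L alpha_le_beta by (simp add: Cmax_def field_simps)
  finally have z: "(LINT t|intv L. (Cmax - B) / \<beta> - \<bar>g t\<bar> / \<alpha>) = 0" .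
  \<comment> \<open>The sign \<open>s\<close> treats the constants Cmax and -Cmax at once.\<close>
  have bd: "(Cmax - B) / \<beta> - \<bar>g t\<bar> / \<alpha> \<le> s * rhs w (s * Cmax) t"
    if a: "\<alpha> \<le> a t" "a t \<le> \<beta>" and s: "s = 1 \<or> s = -1" for s t
  proof -
    have 1: "(Cmax - B) / \<beta> \<le> (Cmax - B) / a t" using Cmax a \<alpha> by (intro divide_left_mono) auto
    have 2: "\<bar>g t\<bar> / a t \<le> \<bar>g t\<bar> / \<alpha>" using a \<alpha> by (intro divide_left_mono) auto
    have "Cmax - B - \<bar>g t\<bar> \<le> s * (\<phi> (w t) + g t + s * Cmax)"
      using s \<phi>(2)[of "w t"] by auto
    then have "(Cmax - B - \<bar>g t\<bar>) / a t \<le> s * rhs w (s * Cmax) t"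
      using a \<alpha> unfolding rhs_def times_divide_eq_right by (intro divide_right_mono) auto
    with 1 2 show ?thesis by (simp add: diff_divide_distrib)
  qed
  have "(LINT t|intv L. (Cmax - B) / \<beta> - \<bar>g t\<bar> / \<alpha>) \<le> (LINT t|intv L. s * rhs w (s * Cmax) t)"
    if "s = 1 \<or> s = -1" for s
  proof (rule integral_mono_AE[OF i])
    show "AE t in intv L. (Cmax - B) / \<beta> - \<bar>g t\<bar> / \<alpha> \<le> s * rhs w (s * Cmax) t"
      using a(2) by eventually_elim (use bd that in blast)
  qed (use integrable_rhs[OF w] in simp)
  note sgn = this[unfolded z]
  show "0 \<le> (LINT t|intv L. rhs w Cmax t)" using sgn[of 1] by simp
  show "(LINT t|intv L. rhs w (- Cmax) t) \<le> 0" using sgn[of "-1"] by simp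
qed

lemma delayed_solution:
  obtains C u where "\<bar>C\<bar> \<le> Cmax" "continuous_on UNIV u" "u L = 0"
    "\<And>x. x \<le> L \<Longrightarrow> u x = prim L (rhs (\<lambda>t. u (t - L / real (Suc n))) C) x"
proof -
  \<comment> \<open>With this delay, \<open>Suc n\<close> stages settle the solution exactly up to
    \<open>L\<close>.\<close>
  define h where "h = L / real (Suc n)"
  have "\<exists>C. - Cmax \<le> C \<and> C \<le> Cmax \<and> tonelli h C (Suc n) L = 0"
  proof (rule IVT')
    show "tonelli h (- Cmax) (Suc n) L \<le> 0" "0 \<le> tonelli h Cmax (Suc n) L"
      by (auto simp: prim_L intro!: integral_rhs_sign borel_measurable_tonelli)
    show "- Cmax \<le> Cmax" using Cmax B_nonneg by simp
    show "continuous_on {- Cmax..Cmax} (\<lambda>C. tonelli h C (Suc n) L)"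
      unfolding continuous_on_sequentially comp_def by (blast intro: tonelli_tendsto)
  qed
  then obtain C where "- Cmax \<le> C" "C \<le> Cmax" and C0: "tonelli h C (Suc n) L = 0" by blast
  then have C: "\<bar>C\<bar> \<le> Cmax" by linarith
  show ?thesis
  proof (rule that[OF C tonelli_continuous C0])
    fix x assume "x \<le> L"
    then have "x \<le> real (Suc n) * h" by (simp add: h_def)
    from tonelli_stable[OF this, of C]
    show "tonelli h C (Suc n) x = prim L (rhs (\<lambda>t. tonelli h C (Suc n) (t - L / real (Suc n))) C) x"
      unfolding tonelli.simps(2)[of h C "Suc n"] h_def by simp
  qed
qed

lemma ex_solution:
  obtains C w where "w \<in> borel_measurable (intv L)" "\<And>x. x \<in> {0..L} \<Longrightarrow> w x = prim L (rhs w C) x" "w L = 0"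
proof -
  have "\<exists>C u. \<bar>C\<bar> \<le> Cmax \<and> continuous_on UNIV u \<and> u L = 0 \<and>
    (\<forall>x\<le>L. u x = prim L (rhs (\<lambda>t. u (t - L / real (Suc n))) C) x)" for n
    by (rule delayed_solution[of n]) blast
  then obtain C u where C: "\<And>n. \<bar>C n\<bar> \<le> Cmax" and cu: "\<And>n. continuous_on UNIV (u n)"
    and uL: "\<And>n. u n L = (0 :: real)"
    and u: "\<And>n x. x \<le> L \<Longrightarrow> u n x = prim L (rhs (\<lambda>t. u n (t - L / real (Suc n))) (C n)) x"
    by metis
  define h where "h n = L / real (Suc n)" for n
  have uh: "u n x = prim L (rhs (\<lambda>t. u n (t - h n)) (C n)) x" if "x \<le> L" for n x
    unfolding h_def by (rule u[OF that])
  \<comment> \<open>Common modulus of continuity of all delayed solutions, valid also for negative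
    arguments.\<close>
  define G where "G = prim L (majorant Cmax)"
  have cG: "continuous_on UNIV G" unfolding G_def by (rule prim_continuous[OF integrable_majorant])
  have mu: "(\<lambda>t. u n (t - h n)) \<in> borel_measurable (intv L)" for n
    by (intro borel_measurable_intv borel_measurable_continuous_onI
      continuous_on_compose2[OF cu]) (auto intro: continuous_intros)
  have mod1: "\<bar>u n y - u n x\<bar> \<le> G y - G x" if "x \<le> y" "y \<le> L" for n x y
  proof -
    have "x \<le> L" using that by simp
    show ?thesis unfolding G_def uh[OF \<open>x \<le> L\<close>] uh[OF \<open>y \<le> L\<close>]
      by (intro prim_diff_le borel_measurable_rhs mu integrable_majorant rhs_le_majorant C that)
  qed
  have mod2: "\<bar>u n x - u n y\<bar> \<le> \<bar>G x - G y\<bar>" if "x \<le> L" "y \<le> L" for n x y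
    using mod1[of x y n] mod1[of y x n] that by (cases "x \<le> y") auto
  have u0: "u n 0 = 0" for n using u[of 0 n] L by simp
  have ub: "norm (u n x, C n) \<le> G L + Cmax" if "x \<in> {0..L}" for n x
  proof -
    have "\<bar>u n x\<bar> \<le> G x" using mod1[of 0 x n] that u0[of n] by (simp add: G_def)
    also have "G x \<le> G L" using mod1[of x L n] that by simp
    finally show ?thesis using norm_Pair_le[of "u n x" "C n"] C[of n] by simp
  qed
  \<comment> \<open>The constant is carried as a second component that does not depend on
    \<open>x\<close>, so one application of Arzela-Ascoli extracts a subsequence for solutions and
    constants together.\<close>
  obtain l k where l: "continuous_on {0..L} l" "strict_mono (k :: nat \<Rightarrow> nat)"
    and conv: "\<And>e. 0 < e \<Longrightarrow> \<exists>N. \<forall>n x. n \<ge> N \<and> x \<in> {0..L} \<longrightarrow> norm ((u (k n) x, C (k n)) - l x) < e"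
  proof (rule Arzela_Ascoli[of "{0..L}" "\<lambda>n x. (u n x, C n)" "G L + Cmax"])
    fix x e :: real assume "x \<in> {0..L}" "0 < e"
    obtain d where d: "0 < d" "\<And>y. \<bar>y - x\<bar> < d \<Longrightarrow> \<bar>G y - G x\<bar> < e"
      using cG \<open>0 < e\<close> unfolding continuous_on_iff dist_real_def by blast
    show "\<exists>d>0. \<forall>n y. y \<in> {0..L} \<and> norm (x - y) < d \<longrightarrow> norm ((u n x, C n) - (u n y, C n)) < e"
    proof (intro exI[of _ d] conjI allI impI d(1))
      fix n y assume y: "y \<in> {0..L} \<and> norm (x - y) < d"
      then have "\<bar>G x - G y\<bar> < e" using d(2)[of y] by (simp add: abs_minus_commute)
      moreover have "\<bar>u n x - u n y\<bar> \<le> \<bar>G x - G y\<bar>" using mod2 y \<open>x \<in> {0..L}\<close> by auto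
      ultimately show "norm ((u n x, C n) - (u n y, C n)) < e" by (simp add: norm_Pair)
    qed
  qed (use ub in auto)
  define w where "w x = fst (l x)" for x
  define C' where "C' = snd (l 0)"
  have liml: "(\<lambda>n. (u (k n) x, C (k n))) \<longlonglongrightarrow> l x" if "x \<in> {0..L}" for x
    unfolding LIMSEQ_iff using conv that by meson
  have limu: "(\<lambda>n. u (k n) x) \<longlonglongrightarrow> w x" if "x \<in> {0..L}" for x
    using tendsto_fst[OF liml[OF that]] by (simp add: w_def)
  have limC: "(\<lambda>n. C (k n)) \<longlonglongrightarrow> C'"
    using tendsto_snd[OF liml[of 0]] L by (simp add: C'_def)
  have "h \<longlonglongrightarrow> 0" unfolding h_def[abs_def]
    by (rule LIMSEQ_Suc[OF lim_const_over_n])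
  then have limh: "(\<lambda>n. h (k n)) \<longlonglongrightarrow> 0" using LIMSEQ_subseq_LIMSEQ[OF _ l(2)] by (simp add: comp_def)
  \<comment> \<open>The delay shifts the argument by a null sequence, and the modulus
    \<open>G\<close> bounds the effect uniformly over the sequence.\<close>
  have limd: "(\<lambda>n. u (k n) (t - h (k n))) \<longlonglongrightarrow> w t" if t: "t \<in> {0<..<L}" for t
  proof -
    have "(\<lambda>n. t - h (k n)) \<longlonglongrightarrow> t" using tendsto_diff[OF tendsto_const[of t] limh] by simp
    moreover have "isCont G t" using cG by (simp add: continuous_on_eq_continuous_at)
    ultimately have "(\<lambda>n. G (t - h (k n))) \<longlonglongrightarrow> G t" by (rule isCont_tendsto_compose[rotated])
    then have "(\<lambda>n. \<bar>G (t - h (k n)) - G t\<bar>) \<longlonglongrightarrow> 0"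
      using tendsto_rabs_zero[OF LIM_zero] by blast
    then have "(\<lambda>n. u (k n) (t - h (k n)) - u (k n) t) \<longlonglongrightarrow> 0"
    proof (rule Lim_null_comparison[rotated])
      have "t - h (k n) \<le> L" for n using t L by (simp add: h_def add_increasing2 diff_le_eq)
      then show "\<forall>\<^sub>F n in sequentially. norm (u (k n) (t - h (k n)) - u (k n) t) \<le> \<bar>G (t - h (k n)) - G t\<bar>"
        using mod2 t by auto
    qed
    from tendsto_add[OF this limu[of t]] t show ?thesis by simp
  qed
  have mw: "w \<in> borel_measurable (intv L)" unfolding w_def
    by (intro borel_measurable_intv_continuous_on continuous_on_fst continuous_on_subset[OF l(1)]) auto
  show ?thesis
  proof (rule that[OF mw])
    fix x assume x: "x \<in> {0..L}"
    have "(\<lambda>n. u (k n) x) \<longlonglongrightarrow> prim L (rhs w C') x"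
      using prim_rhs_tendsto[OF mu[of "k _"] mw limd limC, of x] uh[of x "k _"] x
      by simp
    with limu[OF x] show "w x = prim L (rhs w C') x" by (rule LIMSEQ_unique)
  next
    show "w L = 0" using limu[of L] L uL by (simp add: LIMSEQ_const_iff)
  qed
qed

end

section \<open>Energy estimate, truncation, and the integrated form of the equation\<close>

text \<open>Multiply the integrated equation by \<open>v\<close>: the nonlinear term integrates to
  zero by the chain rule, the constant because \<open>v\<close> has mean zero. Young's inequality
  with weight \<open>\<alpha>\<close> absorbs half of the left side and still yields the sharp
  factor 1 / \<alpha>^2.\<close>

lemma energy_estimate:
  assumes L: "0 < L" and \<alpha>: "0 < \<alpha>" and a: "AE t in intv L. \<alpha> \<le> a t"
    and g: "L2 L g" and v: "L2 L v" "(LINT t|intv L. v t) = 0" and \<phi>: "continuous_on UNIV \<phi>"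
    and eq: "AE t in intv L. a t * v t = \<phi> (prim L v t) + g t + C"
  shows "(LINT t|intv L. (v t)\<^sup>2) \<le> (LINT t|intv L. (g t)\<^sup>2) / \<alpha>\<^sup>2"
proof -
  note iv = L2_integrable[OF v(1)]
  have v2: "integrable (intv L) (\<lambda>t. (v t)\<^sup>2)" and g2: "integrable (intv L) (\<lambda>t. (g t)\<^sup>2)"
    using v g by (auto simp: L2_intv)
  obtain B where B: "\<And>t. \<bar>\<phi> (prim L v t)\<bar> \<le> B"
    using comp_prim_bounded[OF \<phi> iv] by blast
  have i1: "integrable (intv L) (\<lambda>t. \<phi> (prim L v t) * v t)"
    by (rule integrable_bounded_mult[OF iv, where B = B])
      (use B measurable_compose[OF borel_measurable_prim[OF iv] borel_measurable_continuous_onI[OF \<phi>]] in auto)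
  have 1: "AE t in intv L. (\<alpha> / 2) * (v t)\<^sup>2 \<le> (1 / (2 * \<alpha>)) * (g t)\<^sup>2 + \<phi> (prim L v t) * v t + C * v t"
    using a eq
  proof eventually_elim
    case (elim t)
    have "\<alpha> * (v t)\<^sup>2 \<le> a t * (v t)\<^sup>2" using elim by (intro mult_right_mono) auto
    also have "\<dots> = (a t * v t) * v t" by (simp add: power2_eq_square)
    also have "\<dots> = \<phi> (prim L v t) * v t + g t * v t + C * v t"
      unfolding elim(2) by (simp add: algebra_simps)
    finally have "\<alpha> * (v t)\<^sup>2 \<le> \<phi> (prim L v t) * v t + g t * v t + C * v t" .
    moreover have "0 \<le> (g t - \<alpha> * v t)\<^sup>2 / (2 * \<alpha>)" using \<alpha> by simp
    then have "g t * v t \<le> (1 / (2 * \<alpha>)) * (g t)\<^sup>2 + (\<alpha> / 2) * (v t)\<^sup>2"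
      using \<alpha> by (simp add: power2_diff field_simps power2_eq_square)
    ultimately show ?case by linarith
  qed
  have "(LINT t|intv L. (\<alpha> / 2) * (v t)\<^sup>2) \<le> (LINT t|intv L. (1 / (2 * \<alpha>)) * (g t)\<^sup>2 + \<phi> (prim L v t) * v t + C * v t)"
    by (intro integral_mono_AE 1 Bochner_Integration.integrable_add integrable_mult_right v2 g2 i1 iv)
  also have "\<dots> = (1 / (2 * \<alpha>)) * (LINT t|intv L. (g t)\<^sup>2)"
    using v2 g2 i1 iv integral_comp_prim_mult_eq_0[OF L iv \<phi> v(2)] v(2) by simp
  finally have "\<alpha> / 2 * (LINT t|intv L. (v t)\<^sup>2) \<le> (1 / (2 * \<alpha>)) * (LINT t|intv L. (g t)\<^sup>2)" by simp
  then show ?thesis using \<alpha> by (simp add: field_simps power2_eq_square)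
qed

lemma prim_bound_L2:
  assumes "0 < L" "L2 L v"
  shows "\<bar>prim L v x\<bar> \<le> (L + (LINT t|intv L. (v t)\<^sup>2)) / 2"
proof -
  have "\<bar>prim L v x\<bar> \<le> (LINT t|intv L. \<bar>v t\<bar>)" by (rule prim_bound[OF L2_integrable[OF assms(2)]])
  also have "\<dots> \<le> (LINT t|intv L. (1 + (v t)\<^sup>2) / 2)"
  proof (rule integral_mono)
    show "\<bar>v t\<bar> \<le> (1 + (v t)\<^sup>2) / 2" for t
      using zero_le_power2[of "\<bar>v t\<bar> - 1"] by (simp add: power2_diff)
  qed (use assms L2_integrable[OF assms(2)] in \<open>auto simp: L2_intv\<close>)
  also have "\<dots> = (L + (LINT t|intv L. (v t)\<^sup>2)) / 2"
    using assms by (simp add: L2_intv measure_intv)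
  finally show ?thesis .
qed

lemma ex_integrated_solution:
  assumes L: "0 < L" and \<alpha>: "0 < \<alpha>"
    and a: "a \<in> borel_measurable (intv L)" "AE t in intv L. \<alpha> \<le> a t \<and> a t \<le> \<beta>"
    and g2: "L2 L g" and \<phi>: "continuous_on UNIV \<phi>"
  obtains v C where "L2 L v" "(LINT t|intv L. v t) = 0"
    "AE t in intv L. a t * v t = \<phi> (prim L v t) + g t + C"
proof -
  \<comment> \<open>The sup bound that \<open>prim_bound_L2\<close> and the energy estimate give for
    a solution with any continuous nonlinearity. The solution of the truncated problem therefore
    stays where \<open>\<psi>\<close> and \<open>\<phi>\<close> coincide.\<close>
  define R where "R = (L + (LINT t|intv L. (g t)\<^sup>2) / \<alpha>\<^sup>2) / 2"
  define \<psi> where "\<psi> s = \<phi> (max (- R) (min R s))" for s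
  have R: "0 \<le> R" using L by (simp add: R_def)
  have c\<psi>: "continuous_on UNIV \<psi>" unfolding \<psi>_def
    by (rule continuous_on_compose2[OF \<phi>]) (auto intro!: continuous_intros)
  have "compact (\<phi> ` {-R..R})"
    by (intro compact_continuous_image continuous_on_subset[OF \<phi>]) auto
  from compact_imp_bounded[OF this] obtain B where "\<forall>y\<in>\<phi> ` {-R..R}. \<bar>y\<bar> \<le> B"
    unfolding bounded_real by blast
  then have B: "\<bar>\<psi> s\<bar> \<le> B" for s using R by (auto simp: \<psi>_def)
  interpret bounded_problem L \<alpha> \<beta> B a g \<psi>
    by unfold_locales (use L \<alpha> a L2_integrable[OF g2] c\<psi> B in auto)
  obtain C w where w: "w \<in> borel_measurable (intv L)" "\<And>x. x \<in> {0..L} \<Longrightarrow> w x = prim L (rhs w C) x" "w L = 0"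
    by (rule ex_solution) blast
  define v where "v = rhs w C"
  have wv: "w x = prim L v x" if "x \<in> {0..L}" for x using w(2)[OF that] by (simp add: v_def)
  have mv: "v \<in> borel_measurable (intv L)" unfolding v_def by (rule borel_measurable_rhs[OF w(1)])
  \<comment> \<open>The fixed problem yields only an integrable slope; \<open>g\<close> in L2 makes
    the majorant, and with it \<open>v\<close>, square integrable.\<close>
  have "L2 L (\<lambda>t. (1 / \<alpha>) * ((B + \<bar>C\<bar>) + \<bar>g t\<bar>))"
  proof (intro L2_bounded_mult[where B = "\<bar>1 / \<alpha>\<bar>"] L2_add L2_const)
    show "L2 L (\<lambda>t. \<bar>g t\<bar>)" using g2 by (auto simp: L2_intv intro!: borel_measurable_abs)
  qed auto
  then have "integrable (intv L) (\<lambda>t. ((1 / \<alpha>) * ((B + \<bar>C\<bar>) + \<bar>g t\<bar>))\<^sup>2)" by (simp add: L2_intv)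
  moreover have "(1 / \<alpha>) * ((B + \<bar>C\<bar>) + \<bar>g t\<bar>) = majorant \<bar>C\<bar> t" for t by (simp add: majorant_def)
  ultimately have "integrable (intv L) (\<lambda>t. (majorant \<bar>C\<bar> t)\<^sup>2)" by simp
  then have "integrable (intv L) (\<lambda>t. (v t)\<^sup>2)"
  proof (rule Bochner_Integration.integrable_bound)
    show "AE t in intv L. norm ((v t)\<^sup>2) \<le> norm ((majorant \<bar>C\<bar> t)\<^sup>2)"
      using rhs_le_majorant[OF order_refl, of w C]
    proof eventually_elim
      case (elim t)
      then have "\<bar>v t\<bar> \<le> \<bar>majorant \<bar>C\<bar> t\<bar>" by (simp add: v_def)
      then show ?case by (simp add: abs_le_square_iff)
    qed
  qed (use mv in simp)
  then have v2: "L2 L v" using mv by (simp add: L2_intv)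
  have v0: "(LINT t|intv L. v t) = 0" using wv[of L] w(3) L by (simp add: prim_L)
  have "AE t in intv L. a t * v t = \<psi> (prim L v t) + g t + C"
    using a(2) AE_space
  proof eventually_elim
    case (elim t)
    then have "a t * v t = \<psi> (w t) + g t + C" using \<alpha> by (simp add: v_def rhs_def)
    then show ?case using wv[of t] elim by simp
  qed
  note eq = this
  have a': "AE t in intv L. \<alpha> \<le> a t" using a(2) by eventually_elim simp
  have "(LINT t|intv L. (v t)\<^sup>2) \<le> (LINT t|intv L. (g t)\<^sup>2) / \<alpha>\<^sup>2"
    by (rule energy_estimate[OF L \<alpha> a' g2 v2 v0 c\<psi> eq])
  then have "\<bar>prim L v t\<bar> \<le> R" for t
    using prim_bound_L2[OF L v2, of t] by (simp add: R_def)
  then have "\<psi> (prim L v t) = \<phi> (prim L v t)" for t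
    by (simp add: \<psi>_def abs_le_iff min_absorb2 max_absorb2 minus_le_iff)
  with that[OF v2 v0] eq show ?thesis by simp
qed

text \<open>The constant disappears on testing, because derivatives of H^1_0 functions have mean
  zero.\<close>

lemma approx_solI:
  assumes L: "0 < L" and a: "a \<in> borel_measurable (intv L)" and g: "L2 L g"
    and \<phi>: "continuous_on UNIV \<phi>" and v: "L2 L v" "(LINT t|intv L. v t) = 0"
    and eq: "AE t in intv L. a t * v t = \<phi> (prim L v t) + g t + C"
  shows "approx_sol L a g \<phi> (prim L v) v"
  unfolding approx_sol_def set_lint_intv
proof (intro conjI allI impI)
  note iv = L2_integrable[OF v(1)]
  show "H10 L (prim L v) v" by (rule H10_of_prim[OF L v]) simp
  fix z dz assume z: "H10 L z dz"
  then have dz: "L2 L dz" by (simp add: H10_def)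
  have dz0: "(LINT t|intv L. dz t) = 0" by (rule H10_prim(2)[OF L z])
  note idz = L2_integrable[OF dz]
  obtain B where B: "\<And>t. \<bar>\<phi> (prim L v t)\<bar> \<le> B"
    using comp_prim_bounded[OF \<phi> iv] by blast
  have m: "(\<lambda>t. \<phi> (prim L v t)) \<in> borel_measurable (intv L)"
    by (rule measurable_compose[OF borel_measurable_prim[OF iv] borel_measurable_continuous_onI[OF \<phi>]])
  have i1: "integrable (intv L) (\<lambda>t. \<phi> (prim L v t) * dz t)"
    by (rule integrable_bounded_mult[OF idz m, where B = B]) (use B in auto)
  have "(LINT x|intv L. a x * v x * dz x) = (LINT x|intv L. \<phi> (prim L v x) * dz x + g x * dz x + C * dz x)"
  proof (rule integral_cong_AE)
    show "AE x in intv L. a x * v x * dz x = \<phi> (prim L v x) * dz x + g x * dz x + C * dz x"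
      using eq by eventually_elim (simp add: distrib_right)
  qed (use a v dz g m in \<open>auto simp: L2_intv intro!: borel_measurable_times borel_measurable_add\<close>)
  also have "\<dots> = (LINT x|intv L. \<phi> (prim L v x) * dz x) + (LINT x|intv L. g x * dz x)"
    using i1 L2_mult_integrable[OF g dz] idz dz0 by simp
  finally show "(LINT x|intv L. a x * v x * dz x) =
    (LINT x|intv L. \<phi> (prim L v x) * dz x) + (LINT x|intv L. g x * dz x)" .
qed

text \<open>The du Bois-Reymond lemma in L2: the residual \<open>k\<close> is orthogonal to all
  mean-zero functions. Its own deviation from the mean is such a function, and testing with the
  primitive of that deviation gives it norm zero.\<close>

lemma approx_solD:
  assumes L: "0 < L" and a: "a \<in> borel_measurable (intv L)" "AE t in intv L. \<bar>a t\<bar> \<le> \<beta>" and g: "L2 L g"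
    and \<phi>: "continuous_on UNIV \<phi>" and sol: "approx_sol L a g \<phi> u v"
  obtains C where "AE t in intv L. a t * v t = \<phi> (prim L v t) + g t + C"
proof -
  have H: "H10 L u v" using sol by (simp add: approx_sol_def)
  have u: "AE t in intv L. u t = prim L v t" and v0: "(LINT t|intv L. v t) = 0"
    using H10_prim[OF L H] by auto
  have v: "L2 L v" and u2: "L2 L u" using H by (auto simp: H10_def)
  note iv = L2_integrable[OF v]
  obtain B where B: "\<And>t. \<bar>\<phi> (prim L v t)\<bar> \<le> B"
    using comp_prim_bounded[OF \<phi> iv] by blast
  have m: "(\<lambda>t. \<phi> (prim L v t)) \<in> borel_measurable (intv L)"
    by (rule measurable_compose[OF borel_measurable_prim[OF iv] borel_measurable_continuous_onI[OF \<phi>]])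
  have mu: "(\<lambda>t. \<phi> (u t)) \<in> borel_measurable (intv L)"
    using u2 by (intro measurable_compose[OF _ borel_measurable_continuous_onI[OF \<phi>]]) (simp add: L2_intv)
  have L2\<phi>: "L2 L (\<lambda>t. \<phi> (prim L v t))" by (rule L2_bounded[OF m]) (use B in auto)
  have L2av: "L2 L (\<lambda>t. a t * v t)" by (rule L2_bounded_mult[OF v a])
  define k where "k t = a t * v t - \<phi> (prim L v t) - g t" for t
  have L2k: "L2 L k" unfolding k_def by (intro L2_diff L2av L2\<phi> g)
  define C where "C = (LINT t|intv L. k t) / L"
  define e where "e t = k t - C" for t
  have L2e: "L2 L e" unfolding e_def by (intro L2_diff L2k L2_const)
  have e0: "(LINT t|intv L. e t) = 0"
    unfolding e_def using L2_integrable[OF L2k] L by (simp add: C_def measure_intv)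
  have "H10 L (prim L e) e" by (rule H10_of_prim[OF L L2e e0]) simp
  then have "(LINT x|intv L. a x * v x * e x) = (LINT x|intv L. \<phi> (u x) * e x) + (LINT x|intv L. g x * e x)"
    using sol unfolding approx_sol_def set_lint_intv by blast
  also have "(LINT x|intv L. \<phi> (u x) * e x) = (LINT x|intv L. \<phi> (prim L v x) * e x)"
    by (rule integral_cong_AE)
      (use u m mu L2e in \<open>auto simp: L2_intv elim!: eventually_mono intro!: borel_measurable_times\<close>)
  finally have "(LINT x|intv L. k x * e x) = 0"
    using L2_mult_integrable[OF L2av L2e] L2_mult_integrable[OF L2\<phi> L2e] L2_mult_integrable[OF g L2e]
    by (simp add: k_def left_diff_distrib)
  moreover have "(LINT x|intv L. (e x)\<^sup>2) = (LINT x|intv L. k x * e x - C * e x)"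
    by (simp add: e_def power2_eq_square algebra_simps)
  ultimately have "(LINT x|intv L. (e x)\<^sup>2) = 0"
    using L2_mult_integrable[OF L2k L2e] L2_integrable[OF L2e] e0 by simp
  then have "AE x in intv L. (e x)\<^sup>2 = 0"
    using L2e integral_nonneg_eq_0_iff_AE[of "intv L" "\<lambda>x. (e x)\<^sup>2"] by (simp add: L2_intv)
  then have "AE t in intv L. a t * v t = \<phi> (prim L v t) + g t + C"
    by eventually_elim (simp add: e_def k_def)
  then show ?thesis by (rule that)
qed

section \<open>Passage to the limit\<close>

text \<open>An instance of Vitali's theorem: an L2 bound gives uniform integrability, so a.e.
  convergence becomes convergence in L1, which suffices against a bounded factor.\<close>

lemma tendsto_integral_mult_of_L2_bounded:
  fixes f :: "nat \<Rightarrow> real \<Rightarrow> real"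
  assumes f: "\<And>k. L2 L (f k)" "L2 L f'"
    and K: "\<And>k. (LINT x|intv L. (f k x)\<^sup>2) \<le> K"
    and lim: "AE x in intv L. (\<lambda>k. f k x) \<longlonglongrightarrow> f' x"
    and h: "h \<in> borel_measurable (intv L)" "AE x in intv L. \<bar>h x\<bar> \<le> H"
  shows "(\<lambda>k. LINT x|intv L. f k x * h x) \<longlonglongrightarrow> (LINT x|intv L. f' x * h x)"
proof -
  define d where "d k x = \<bar>f k x - f' x\<bar>" for k x
  have L2d: "L2 L (d k)" for k
    using L2_diff[OF f(1)[of k] f(2)] unfolding d_def by (auto simp: L2_intv intro!: borel_measurable_abs)
  have d0: "0 \<le> d k x" for k x by (simp add: d_def)
  define K' where "K' = 2 * K + 2 * (LINT x|intv L. (f' x)\<^sup>2)"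
  have dK: "(LINT x|intv L. (d k x)\<^sup>2) \<le> K'" for k
  proof -
    have "(LINT x|intv L. (d k x)\<^sup>2) \<le> (LINT x|intv L. 2 * (f k x)\<^sup>2 + 2 * (f' x)\<^sup>2)"
    proof (rule integral_mono)
      show "(d k x)\<^sup>2 \<le> 2 * (f k x)\<^sup>2 + 2 * (f' x)\<^sup>2" for x
        using zero_le_power2[of "f k x + f' x"] by (simp add: d_def power2_sum power2_diff)
    qed (use L2d[of k] f in \<open>auto simp: L2_intv\<close>)
    also have "\<dots> = 2 * (LINT x|intv L. (f k x)\<^sup>2) + 2 * (LINT x|intv L. (f' x)\<^sup>2)"
      using f by (simp add: L2_intv)
    also have "\<dots> \<le> K'" using K[of k] by (simp add: K'_def)
    finally show ?thesis .
  qed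
  have limd: "(\<lambda>k. LINT x|intv L. d k x) \<longlonglongrightarrow> 0"
  proof (rule LIMSEQ_I)
    fix r :: real assume r: "0 < r"
    \<comment> \<open>Truncation level with K' / M at most r / 2. The part of \<open>d k\<close>
      below \<open>M\<close> is handled by dominated convergence; where \<open>d k\<close> exceeds
      \<open>M\<close> it is at most its square divided by \<open>M\<close>.\<close>
    define M where "M = 2 * (\<bar>K'\<bar> + 1) / r"
    have M: "0 < M" using r by (simp add: M_def)
    have mm: "(\<lambda>x. min (d k x) M) \<in> borel_measurable (intv L)" for k
      using L2d[of k] by (intro borel_measurable_min) (auto simp: L2_intv)
    have im: "integrable (intv L) (\<lambda>x. min (d k x) M)" for k
      by (rule integrable_intv_bounded[OF mm, of _ M]) (use M d0[of k] in auto)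
    have "(\<lambda>k. LINT x|intv L. min (d k x) M) \<longlonglongrightarrow> (LINT x|intv L. 0)"
    proof (rule integral_dominated_convergence[where w = "\<lambda>_. M"])
      show "AE x in intv L. (\<lambda>k. min (d k x) M) \<longlonglongrightarrow> 0"
        using lim
      proof eventually_elim
        case (elim x)
        have "(\<lambda>k. d k x) \<longlonglongrightarrow> 0" unfolding d_def by (intro tendsto_rabs_zero LIM_zero elim)
        from tendsto_min[OF this tendsto_const[of M]] M show ?case by simp
      qed
      show "AE x in intv L. norm (min (d k x) M) \<le> M" for k using d0[of k] M by auto
    qed (use mm in auto)
    then obtain N where N: "\<And>k. N \<le> k \<Longrightarrow> \<bar>LINT x|intv L. min (d k x) M\<bar> < r / 2"
      using r unfolding LIMSEQ_iff by (metis half_gt_zero diff_zero integral_zero real_norm_def)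
    show "\<exists>N. \<forall>k\<ge>N. norm ((LINT x|intv L. d k x) - 0) < r"
    proof (intro exI allI impI)
      fix k assume k: "N \<le> k"
      have "(LINT x|intv L. d k x) \<le> (LINT x|intv L. min (d k x) M + (d k x)\<^sup>2 / M)"
      proof (rule integral_mono)
        show "d k x \<le> min (d k x) M + (d k x)\<^sup>2 / M" for x
        proof (cases "d k x \<le> M")
          case True
          then show ?thesis using M by simp
        next
          case False
          then have "M * d k x \<le> (d k x)\<^sup>2" using d0[of k x] by (simp add: power2_eq_square mult_right_mono)
          then have "d k x \<le> (d k x)\<^sup>2 / M" using M by (simp add: field_simps)
          then show ?thesis using M d0[of k x] by (simp add: add_increasing)
        qed
      qed (use L2_integrable[OF L2d[of k]] L2d[of k] im[of k] in \<open>auto simp: L2_intv\<close>)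
      also have "\<dots> = (LINT x|intv L. min (d k x) M) + (LINT x|intv L. (d k x)\<^sup>2) / M"
        using im[of k] L2d[of k] by (simp add: L2_intv)
      also have "\<dots> < r / 2 + K' / M"
        using N[OF k] dK[of k] M by (intro add_less_le_mono divide_right_mono) auto
      also have "K' / M \<le> r / 2"
      proof -
        have "r * K' \<le> r * (\<bar>K'\<bar> + 1)" using r by (intro mult_left_mono) auto
        then show ?thesis using r by (simp add: M_def field_simps)
      qed
      finally have "(LINT x|intv L. d k x) < r" by simp
      moreover have "0 \<le> (LINT x|intv L. d k x)" by (intro integral_nonneg_AE) (simp add: d0)
      ultimately show "norm ((LINT x|intv L. d k x) - 0) < r" by simp
    qed
  qed
  have ih: "integrable (intv L) (\<lambda>x. f k x * h x)" for k
    using integrable_bounded_mult[OF L2_integrable[OF f(1)] h, of k] by (simp add: mult.commute)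
  have ih': "integrable (intv L) (\<lambda>x. f' x * h x)"
    using integrable_bounded_mult[OF L2_integrable[OF f(2)] h] by (simp add: mult.commute)
  have "(\<lambda>k. (LINT x|intv L. f k x * h x) - (LINT x|intv L. f' x * h x)) \<longlonglongrightarrow> 0"
  proof (rule Lim_null_comparison)
    show "\<forall>\<^sub>F k in sequentially. norm ((LINT x|intv L. f k x * h x) - (LINT x|intv L. f' x * h x))
        \<le> H * (LINT x|intv L. d k x)"
    proof (intro always_eventually allI)
      fix k
      have "(LINT x|intv L. f k x * h x) - (LINT x|intv L. f' x * h x) = (LINT x|intv L. f k x * h x - f' x * h x)"
        using ih[of k] ih' by simp
      also have "norm \<dots> \<le> (LINT x|intv L. \<bar>f k x * h x - f' x * h x\<bar>)"
        unfolding real_norm_def by (rule integral_abs_bound)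
      also have "\<dots> \<le> (LINT x|intv L. H * d k x)"
      proof (rule integral_mono_AE)
        show "AE x in intv L. \<bar>f k x * h x - f' x * h x\<bar> \<le> H * d k x"
          using h(2)
        proof eventually_elim
          case (elim x)
          then have "\<bar>h x\<bar> * d k x \<le> H * d k x" using d0 by (intro mult_right_mono)
          moreover have "\<bar>f k x * h x - f' x * h x\<bar> = \<bar>h x\<bar> * d k x"
            by (simp add: d_def left_diff_distrib[symmetric] abs_mult)
          ultimately show ?case by simp
        qed
      qed (use ih[of k] ih' L2_integrable[OF L2d[of k]] in auto)
      also have "\<dots> = H * (LINT x|intv L. d k x)" by simp
      finally show "norm ((LINT x|intv L. f k x * h x) - (LINT x|intv L. f' x * h x)) \<le> H * (LINT x|intv L. d k x)" .
    qed
    show "(\<lambda>k. H * (LINT x|intv L. d k x)) \<longlonglongrightarrow> 0" using tendsto_mult_left[OF limd, of H] by simp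
  qed
  then show ?thesis by (rule LIM_zero_cancel)
qed

text \<open>The definition speaks of full sequences only, so the sequence along \<open>r\<close> is
  completed by its limit \<open>s0\<close> at the missing indices.\<close>

lemma reasonable_approx_subseq:
  assumes "reasonable_approx \<Phi> \<phi>" "strict_mono (r :: nat \<Rightarrow> nat)" "s \<longlonglongrightarrow> s0"
  shows "(\<lambda>k. \<Phi> (r k) (s k)) \<longlonglongrightarrow> \<phi> s0"
proof -
  have inj: "inj r" by (rule strict_mono_imp_inj_on[OF assms(2)])
  define s' where "s' n = (if n \<in> range r then s (inv r n) else s0)" for n
  have "s' \<longlonglongrightarrow> s0"
  proof (rule topological_tendstoI)
    fix A assume A: "open A" "s0 \<in> A"
    then obtain N where N: "\<And>k. N \<le> k \<Longrightarrow> s k \<in> A"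
      using topological_tendstoD[OF assms(3)] unfolding eventually_sequentially by blast
    have "s' n \<in> A" if n: "r N \<le> n" for n
    proof (cases "n \<in> range r")
      case True
      then obtain k where k: "n = r k" by blast
      then have "N \<le> k" using n assms(2) by (simp add: strict_mono_less_eq)
      then show ?thesis using N k inj by (simp add: s'_def)
    qed (use A in \<open>simp add: s'_def\<close>)
    then show "\<forall>\<^sub>F n in sequentially. s' n \<in> A" unfolding eventually_sequentially by blast
  qed
  then have "(\<lambda>n. \<Phi> n (s' n)) \<longlonglongrightarrow> \<phi> s0" using assms(1) by (simp add: reasonable_approx_def)
  from LIMSEQ_subseq_LIMSEQ[OF this assms(2)] show ?thesis
    using inj by (simp add: comp_def s'_def)
qed

text \<open>On a set of positive measure the limit stays away from the singularity, so the terms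
  \<open>f k\<close> are bounded there; this bounds the constants.\<close>

lemma constants_bounded:
  fixes f h :: "nat \<Rightarrow> real \<Rightarrow> real"
  assumes h: "\<And>k. L2 L (h k)" "\<And>k. (LINT x|intv L. (h k x)\<^sup>2) \<le> K"
    and f: "\<And>k. f k \<in> borel_measurable (intv L)"
    and eq: "\<And>k. AE x in intv L. h k x = f k x + C k"
    and bdd: "\<not> (AE x in intv L. \<forall>N. \<exists>k. N < \<bar>f k x\<bar>)"
  obtains B where "\<And>k. (C k)\<^sup>2 \<le> B"
proof -
  define E where "E N = {x \<in> space (intv L). \<forall>k. \<bar>f k x\<bar> \<le> real N}" for N :: nat
  have mE: "E N \<in> sets (intv L)" for N
  proof -
    have "{x \<in> space (intv L). \<bar>f k x\<bar> \<le> real N} \<in> sets (intv L)" for k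
      using borel_measurable_abs[OF f[of k]] by (simp only: borel_measurable_iff_le)
    moreover have "E N = (\<Inter>k. {x \<in> space (intv L). \<bar>f k x\<bar> \<le> real N})" by (auto simp: E_def)
    ultimately show ?thesis by (auto intro: sets.countable_INT)
  qed
  \<comment> \<open>Outside the union of the \<open>E N\<close> the values are unbounded in
    \<open>k\<close>; if every \<open>E N\<close> were null, this would hold almost everywhere,
    against \<open>bdd\<close>.\<close>
  have "\<exists>N. emeasure (intv L) (E N) \<noteq> 0"
  proof (rule ccontr)
    assume "\<nexists>N. emeasure (intv L) (E N) \<noteq> 0"
    then have "AE x in intv L. x \<notin> E N" for N
      using mE[of N] by (intro AE_not_in) (auto simp: null_sets_def)
    then have "AE x in intv L. \<forall>N. x \<notin> E N" by (simp add: AE_all_countable)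
    then have "AE x in intv L. \<forall>N. \<exists>k. N < \<bar>f k x\<bar>"
      using AE_space
    proof eventually_elim
      case (elim x)
      show ?case
      proof
        fix N :: real
        obtain n :: nat where "N \<le> real n" using real_arch_simple by blast
        moreover obtain k where "real n < \<bar>f k x\<bar>" using elim by (auto simp: E_def not_le)
        ultimately show "\<exists>k. N < \<bar>f k x\<bar>" by (meson le_less_trans)
      qed
    qed
    with bdd show False by simp
  qed
  then obtain N where "emeasure (intv L) (E N) \<noteq> 0" by blast
  then have pos: "0 < measure (intv L) (E N)"
    using finite_measure.emeasure_eq_measure[OF finite_measure_intv, of L "E N"]
    by (auto simp: zero_less_measure_iff)
  \<comment> \<open>On \<open>E N\<close> the constant is the difference of \<open>h k\<close> and a
    term bounded by N, so its square is at most twice the sum of their squares. Integrating over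
    \<open>E N\<close> gives the quotient.\<close>
  have "(C k)\<^sup>2 \<le> (2 * K + 2 * (real N)\<^sup>2 * measure (intv L) {0<..<L}) / measure (intv L) (E N)" for k
  proof -
    have *: "(LINT x|intv L. indicator (E N) x * (C k)\<^sup>2) \<le> (LINT x|intv L. 2 * (h k x)\<^sup>2 + 2 * (real N)\<^sup>2)"
    proof (rule integral_mono_AE)
      show "AE x in intv L. indicator (E N) x * (C k)\<^sup>2 \<le> 2 * (h k x)\<^sup>2 + 2 * (real N)\<^sup>2"
        using eq[of k]
      proof eventually_elim
        case (elim x)
        show ?case
        proof (cases "x \<in> E N")
          case True
          then have "(f k x)\<^sup>2 \<le> (real N)\<^sup>2" by (simp add: E_def abs_le_square_iff[symmetric])
          moreover have "(C k)\<^sup>2 \<le> 2 * (h k x)\<^sup>2 + 2 * (f k x)\<^sup>2"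
          proof -
            have "C k = h k x - f k x" using elim by simp
            then show ?thesis using zero_le_power2[of "h k x + f k x"] by (simp add: power2_sum power2_diff)
          qed
          ultimately show ?thesis using True by simp
        qed simp
      qed
      show "integrable (intv L) (\<lambda>x. indicator (E N) x * (C k)\<^sup>2)"
        by (rule integrable_intv_bounded[where B = "(C k)\<^sup>2"])
          (use mE in \<open>auto simp: indicator_def\<close>)
    qed (use h(1)[of k] in \<open>simp add: L2_intv\<close>)
    have "(C k)\<^sup>2 * measure (intv L) (E N) \<le> 2 * K + 2 * (real N)\<^sup>2 * measure (intv L) {0<..<L}"
    proof -
      have "E N \<inter> {0<..<L} = E N" by (auto simp: E_def)
      then have "(LINT x|intv L. indicator (E N) x * (C k)\<^sup>2) = (C k)\<^sup>2 * measure (intv L) (E N)"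
        by (simp add: mult.commute)
      moreover have "(LINT x|intv L. 2 * (h k x)\<^sup>2 + 2 * (real N)\<^sup>2)
          = 2 * (LINT x|intv L. (h k x)\<^sup>2) + 2 * (real N)\<^sup>2 * measure (intv L) {0<..<L}"
        using h(1)[of k] by (simp add: L2_intv)
      ultimately show ?thesis using * h(2)[of k] by linarith
    qed
    then show ?thesis using pos by (simp add: pos_le_divide_eq)
  qed
  then show ?thesis by (rule that)
qed

text \<open>Fatou is applied to the squares as extended nonnegative functions, so that points with
  infinite limit are counted: there the liminf of the squares is infinite, which a finite integral
  permits only on a null set.\<close>

lemma Fatou_L2:
  fixes f :: "nat \<Rightarrow> real \<Rightarrow> real" and F :: "real \<Rightarrow> ereal"
  assumes f: "\<And>k. L2 L (f k)" "\<And>k. (LINT x|intv L. (f k x)\<^sup>2) \<le> K"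
    and F: "F \<in> borel_measurable (intv L)" "AE x in intv L. F x \<noteq> -\<infinity>"
    and lim: "AE x in intv L. (\<lambda>k. ereal (f k x)) \<longlonglongrightarrow> F x"
  shows "AE x in intv L. F x \<noteq> \<infinity>" "L2 L (\<lambda>x. real_of_ereal (F x))"
proof -
  have mf: "f k \<in> borel_measurable (intv L)" for k using f(1)[of k] by (simp add: L2_intv)
  let ?l = "\<lambda>x. liminf (\<lambda>k. ennreal ((f k x)\<^sup>2))"
  have m: "(\<lambda>x. ennreal ((f k x)\<^sup>2)) \<in> borel_measurable (intv L)" for k
    using mf[of k] by simp
  have "(\<integral>\<^sup>+x. ?l x \<partial>intv L) \<le> liminf (\<lambda>k. \<integral>\<^sup>+x. ennreal ((f k x)\<^sup>2) \<partial>intv L)"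
    by (rule nn_integral_liminf[OF m])
  also have "\<dots> \<le> liminf (\<lambda>k. ennreal K)"
  proof (intro Liminf_mono always_eventually allI)
    fix k
    have "(\<integral>\<^sup>+x. ennreal ((f k x)\<^sup>2) \<partial>intv L) = ennreal (LINT x|intv L. (f k x)\<^sup>2)"
      using f(1)[of k] by (intro nn_integral_eq_integral) (auto simp: L2_intv)
    also have "\<dots> \<le> ennreal K" by (intro ennreal_leI f(2))
    finally show "(\<integral>\<^sup>+x. ennreal ((f k x)\<^sup>2) \<partial>intv L) \<le> ennreal K" .
  qed
  also have "\<dots> = ennreal K" by (simp add: Liminf_const)
  finally have fin: "(\<integral>\<^sup>+x. ?l x \<partial>intv L) \<le> ennreal K" .
  have ml: "?l \<in> borel_measurable (intv L)" by (rule borel_measurable_liminf[OF m])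
  have "AE x in intv L. ?l x \<noteq> \<infinity>"
    by (rule nn_integral_PInf_AE[OF ml]) (use fin in \<open>auto simp: top_unique\<close>)
  then show fF: "AE x in intv L. F x \<noteq> \<infinity>"
    using lim
  proof eventually_elim
    case (elim x)
    show ?case
    proof
      assume "F x = \<infinity>"
      with elim have "(\<lambda>k. ereal (f k x)) \<longlonglongrightarrow> \<infinity>" by simp
      then have "filterlim (\<lambda>k. f k x) at_top sequentially" by (simp add: tendsto_PInfty_eq_at_top)
      then have "filterlim (\<lambda>k. (f k x)\<^sup>2) at_top sequentially"
        by (intro filterlim_pow_at_top) auto
      then have "(\<lambda>k. ennreal ((f k x)\<^sup>2)) \<longlonglongrightarrow> top"
        by (simp add: ennreal_tendsto_top_eq_at_top)
      then have "?l x = top" by (intro lim_imp_Liminf) auto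
      with elim show False by simp
    qed
  qed
  have "AE x in intv L. ennreal ((real_of_ereal (F x))\<^sup>2) = ?l x"
    using fF F(2) lim
  proof eventually_elim
    case (elim x)
    then obtain c where c: "F x = ereal c" by (cases "F x") auto
    with elim have "(\<lambda>k. f k x) \<longlonglongrightarrow> c" by simp
    then have "(\<lambda>k. ennreal ((f k x)\<^sup>2)) \<longlonglongrightarrow> ennreal (c\<^sup>2)"
      by (intro tendsto_ennrealI tendsto_power)
    then have "?l x = ennreal (c\<^sup>2)" by (intro lim_imp_Liminf) auto
    with c show ?case by simp
  qed
  then have "(\<integral>\<^sup>+x. ennreal ((real_of_ereal (F x))\<^sup>2) \<partial>intv L) = (\<integral>\<^sup>+x. ?l x \<partial>intv L)"
    by (rule nn_integral_cong_AE)
  then have "(\<integral>\<^sup>+x. ennreal ((real_of_ereal (F x))\<^sup>2) \<partial>intv L) < \<infinity>"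
    using fin by (simp add: le_less_trans[OF _ ennreal_less_top])
  moreover have mF: "(\<lambda>x. real_of_ereal (F x)) \<in> borel_measurable (intv L)"
    using F(1) by simp
  ultimately show "L2 L (\<lambda>x. real_of_ereal (F x))"
    unfolding L2_intv by (intro conjI integrableI_nonneg) auto
qed

lemma tendsto_integral_mult_0:
  assumes p: "\<And>k. L2 L (p k)" "(\<lambda>k. LINT x|intv L. (p k x)\<^sup>2) \<longlonglongrightarrow> 0"
    and d: "\<And>k. L2 L (d k)" "\<And>k. (LINT x|intv L. (d k x)\<^sup>2) \<le> K"
  shows "(\<lambda>k. LINT x|intv L. p k x * d k x) \<longlonglongrightarrow> 0"
proof (rule LIMSEQ_I)
  fix r :: real assume r: "0 < r"
  \<comment> \<open>Weight for Young's inequality: it makes the term with \<open>d k\<close> at most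
    r / 2, and the other term is below r / 2 as soon as the integral of the square of
    \<open>p k\<close> is below \<open>r * e\<close>.\<close>
  define e where "e = r / (\<bar>K\<bar> + 1)"
  have e: "0 < e" using r by (simp add: e_def add_nonneg_pos)
  then have "0 < r * e" using r by simp
  from LIMSEQ_D[OF p(2) this] obtain N where N: "\<And>k. N \<le> k \<Longrightarrow> (LINT x|intv L. (p k x)\<^sup>2) < r * e"
    by (auto dest: abs_le_D1)
  show "\<exists>N. \<forall>k\<ge>N. norm ((LINT x|intv L. p k x * d k x) - 0) < r"
  proof (intro exI allI impI)
    fix k assume k: "N \<le> k"
    have "\<bar>LINT x|intv L. p k x * d k x\<bar> \<le> (LINT x|intv L. \<bar>p k x * d k x\<bar>)"
      by (rule integral_abs_bound)
    also have "\<dots> \<le> (LINT x|intv L. (p k x)\<^sup>2 / (2 * e) + (e / 2) * (d k x)\<^sup>2)"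
    proof (rule integral_mono)
      fix x
      have "0 \<le> (\<bar>p k x\<bar> - e * \<bar>d k x\<bar>)\<^sup>2 / (2 * e)" using e by simp
      also have "\<dots> = (p k x)\<^sup>2 / (2 * e) + (e / 2) * (d k x)\<^sup>2 - \<bar>p k x\<bar> * \<bar>d k x\<bar>"
        using e by (simp add: power2_diff power_mult_distrib field_simps power2_eq_square)
      finally show "\<bar>p k x * d k x\<bar> \<le> (p k x)\<^sup>2 / (2 * e) + (e / 2) * (d k x)\<^sup>2"
        by (simp add: abs_mult)
    qed (use p(1)[of k] d(1)[of k] L2_mult_integrable[OF p(1)[of k] d(1)[of k]] in \<open>auto simp: L2_intv\<close>)
    also have "\<dots> = (LINT x|intv L. (p k x)\<^sup>2) / (2 * e) + (e / 2) * (LINT x|intv L. (d k x)\<^sup>2)"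
      using p(1)[of k] d(1)[of k] by (simp add: L2_intv)
    also have "\<dots> < r * e / (2 * e) + (e / 2) * K"
      using N[OF k] d(2)[of k] e
      by (intro add_less_le_mono divide_strict_right_mono mult_left_mono) auto
    also have "r * e / (2 * e) = r / 2" using e by simp
    also have "(e / 2) * K \<le> r / 2"
    proof -
      have "e * K \<le> e * (\<bar>K\<bar> + 1)" using e by (intro mult_left_mono) auto
      also have "\<dots> = r" unfolding e_def by simp
      finally show ?thesis by simp
    qed
    finally show "norm ((LINT x|intv L. p k x * d k x) - 0) < r" by simp
  qed
qed

text \<open>Weak convergence in H^1_0 is tested with the full inner product. Taking for
  \<open>z\<close> the primitive of \<open>q\<close> minus its mean, the mean contributes nothing
  since the derivatives have mean zero, and the zero-order term converges by dominated
  convergence.\<close>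

lemma weak_conv_H10_deriv:
  assumes L: "0 < L" and wc: "weak_conv_H10 L U DU u du"
    and H: "\<And>k. H10 L (U k) (DU k)" "H10 L u du"
    and lim: "AE x in intv L. (\<lambda>k. U k x) \<longlonglongrightarrow> u x"
    and bd: "\<And>k. (LINT x|intv L. (DU k x)\<^sup>2) \<le> K" and q: "L2 L q"
  shows "(\<lambda>k. LINT x|intv L. DU k x * q x) \<longlonglongrightarrow> (LINT x|intv L. du x * q x)"
proof -
  have L2: "L2 L (U k)" "L2 L (DU k)" "L2 L u" "L2 L du" for k using H by (auto simp: H10_def)
  define m where "m = (LINT t|intv L. q t) / L"
  define dz where "dz t = q t - m" for t
  have L2dz: "L2 L dz" unfolding dz_def by (intro L2_diff q L2_const)
  have dz0: "(LINT t|intv L. dz t) = 0"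
    unfolding dz_def using L2_integrable[OF q] L by (simp add: m_def measure_intv)
  define z where "z = prim L dz"
  have Hz: "H10 L z dz" by (rule H10_of_prim[OF L L2dz dz0]) (simp add: z_def)
  have L2z: "L2 L z" using Hz by (simp add: H10_def)
  have 1: "(\<lambda>k. LINT x|intv L. U k x * z x + DU k x * dz x) \<longlonglongrightarrow> (LINT x|intv L. u x * z x + du x * dz x)"
    using wc Hz unfolding weak_conv_H10_def set_lint_intv by blast
  have 2: "(\<lambda>k. LINT x|intv L. U k x * z x) \<longlonglongrightarrow> (LINT x|intv L. u x * z x)"
  proof (rule integral_dominated_convergence[where w = "\<lambda>x. (L + K) / 2 * \<bar>z x\<bar>"])
    show "AE x in intv L. (\<lambda>k. U k x * z x) \<longlonglongrightarrow> u x * z x"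
      using lim by eventually_elim (intro tendsto_mult tendsto_const)
    show "AE x in intv L. norm (U k x * z x) \<le> (L + K) / 2 * \<bar>z x\<bar>" for k
      using H10_prim(1)[OF L H(1)[of k]]
    proof eventually_elim
      case (elim x)
      have "\<bar>U k x\<bar> \<le> (L + K) / 2"
        using prim_bound_L2[OF L L2(2)[of k], of x] bd[of k] elim by simp
      from mult_right_mono[OF this, of "\<bar>z x\<bar>"] show ?case by (simp add: abs_mult)
    qed
  qed (use L2 L2z L2_integrable[OF L2z] in \<open>auto simp: L2_intv intro!: borel_measurable_times\<close>)
  have split: "(LINT x|intv L. V x * z x + DV x * dz x) - (LINT x|intv L. V x * z x) = (LINT x|intv L. DV x * q x)"
    if "L2 L V" "L2 L DV" "(LINT x|intv L. DV x) = 0" for V DV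
  proof -
    have "(LINT x|intv L. V x * z x + DV x * dz x) - (LINT x|intv L. V x * z x) = (LINT x|intv L. DV x * dz x)"
      using L2_mult_integrable[OF that(1) L2z] L2_mult_integrable[OF that(2) L2dz] by simp
    also have "\<dots> = (LINT x|intv L. DV x * q x - m * DV x)"
      by (simp add: dz_def algebra_simps)
    also have "\<dots> = (LINT x|intv L. DV x * q x)"
      using L2_mult_integrable[OF that(2) q] L2_integrable[OF that(2)] that(3) by simp
    finally show ?thesis .
  qed
  show ?thesis
    using tendsto_diff[OF 1 2] split[OF L2(1,2) H10_prim(2)[OF L H(1)]] split[OF L2(3,4) H10_prim(2)[OF L H(2)]]
    by simp
qed

lemma approx_sol_energy:
  assumes L: "0 < L" and \<alpha>: "0 < \<alpha>"
    and a: "a \<in> borel_measurable (intv L)" "AE t in intv L. \<alpha> \<le> a t \<and> a t \<le> \<beta>"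
    and g: "L2 L g" and \<phi>: "continuous_on UNIV \<phi>" and sol: "approx_sol L a g \<phi> u v"
  obtains C where "AE t in intv L. a t * v t = \<phi> (prim L v t) + g t + C"
    "(LINT t|intv L. (v t)\<^sup>2) \<le> (LINT t|intv L. (g t)\<^sup>2) / \<alpha>\<^sup>2"
proof -
  have a': "AE t in intv L. \<alpha> \<le> a t" using a(2) by eventually_elim simp
  have "AE t in intv L. \<bar>a t\<bar> \<le> \<beta>" using a(2) by eventually_elim (use \<alpha> in auto)
  from approx_solD[OF L a(1) this g \<phi> sol]
  obtain C where C: "AE t in intv L. a t * v t = \<phi> (prim L v t) + g t + C" .
  have H: "H10 L u v" using sol by (simp add: approx_sol_def)
  then have "L2 L v" by (simp add: H10_def)
  from energy_estimate[OF L \<alpha> a' g this H10_prim(2)[OF L H] \<phi> C] C that show ?thesis by blast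
qed

lemma weak_sol_of_limit:
  fixes A G P :: "nat \<Rightarrow> real \<Rightarrow> real"
  assumes L: "0 < L" and \<alpha>: "0 < \<alpha>"
    and a: "a \<in> borel_measurable (intv L)" "AE t in intv L. \<alpha> \<le> a t \<and> a t \<le> \<beta>"
    and A: "\<And>k. A k \<in> borel_measurable (intv L)" "\<And>k. AE t in intv L. \<alpha> \<le> A k t \<and> A k t \<le> \<beta>"
    and Aa: "AE t in intv L. (\<lambda>k. A k t) \<longlonglongrightarrow> a t"
    and G: "\<And>k. L2 L (G k)" "\<And>k. (LINT x|intv L. (G k x)\<^sup>2) \<le> c" and Gg: "weak_conv_L2 L G g"
    and P: "\<And>k. continuous_on UNIV (P k)" "\<And>s s0. s \<longlonglongrightarrow> s0 \<Longrightarrow> (\<lambda>k. ereal (P k (s k))) \<longlonglongrightarrow> \<phi> s0"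
    and \<phi>: "H_phi \<phi>"
    and sol: "\<And>k. approx_sol L (A k) (G k) (P k) (U k) (DU k)"
    and Hu: "H10 L u du" and wc: "weak_conv_H10 L U DU u du"
    and lim: "AE x in intv L. (\<lambda>k. U k x) \<longlonglongrightarrow> u x"
    and nz: "\<not> (AE x in intv L. u x = 0)"
  shows "weak_sol L a g \<phi> u du"
proof -
  have H: "H10 L (U k) (DU k)" for k using sol[of k] by (simp add: approx_sol_def)
  have DU: "L2 L (DU k)" for k using H[of k] by (simp add: H10_def)
  note iDU = L2_integrable[OF DU]
  have Ab: "AE t in intv L. \<bar>A k t\<bar> \<le> \<beta>" for k using A(2)[of k] by eventually_elim (use \<alpha> in auto)
  have ab: "AE t in intv L. \<bar>a t\<bar> \<le> \<beta>" using a(2) by eventually_elim (use \<alpha> in auto)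
  have "\<exists>C. (AE t in intv L. A k t * DU k t = P k (prim L (DU k) t) + G k t + C) \<and>
    (LINT t|intv L. (DU k t)\<^sup>2) \<le> (LINT t|intv L. (G k t)\<^sup>2) / \<alpha>\<^sup>2" for k
    by (rule approx_sol_energy[OF L \<alpha> A G(1) P(1) sol, of k]) blast
  then obtain C where C: "\<And>k. AE t in intv L. A k t * DU k t = P k (prim L (DU k) t) + G k t + C k"
    and en: "\<And>k. (LINT t|intv L. (DU k t)\<^sup>2) \<le> (LINT t|intv L. (G k t)\<^sup>2) / \<alpha>\<^sup>2" by metis
  define K1 where "K1 = c / \<alpha>\<^sup>2"
  have en1: "(LINT t|intv L. (DU k t)\<^sup>2) \<le> K1" for k
    using order_trans[OF en[of k] divide_right_mono[OF G(2)[of k]]] by (simp add: K1_def)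
  define f where "f k x = P k (prim L (DU k) x)" for k x
  \<comment> \<open>The sum of the nonlinear term and the constant, read off from the other side of
    the equation: it is bounded in L2 by the energy estimate, whatever the singularity does.\<close>
  define h where "h k x = A k x * DU k x - G k x" for k x
  have hL2: "L2 L (h k)" for k
    unfolding h_def by (intro L2_diff G L2_bounded_mult[OF DU A(1) Ab])
  have mf: "f k \<in> borel_measurable (intv L)" for k
    unfolding f_def
    by (rule measurable_compose[OF borel_measurable_prim[OF iDU] borel_measurable_continuous_onI[OF P(1)]])
  have hf: "AE x in intv L. h k x = f k x + C k" for k
    using C[of k] by eventually_elim (simp add: h_def f_def)
  have hK: "(LINT x|intv L. (h k x)\<^sup>2) \<le> 2 * \<beta>\<^sup>2 * K1 + 2 * c" for k
  proof -
    have "(LINT x|intv L. (h k x)\<^sup>2) \<le> (LINT x|intv L. 2 * \<beta>\<^sup>2 * (DU k x)\<^sup>2 + 2 * (G k x)\<^sup>2)"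
    proof (rule integral_mono_AE)
      show "AE x in intv L. (h k x)\<^sup>2 \<le> 2 * \<beta>\<^sup>2 * (DU k x)\<^sup>2 + 2 * (G k x)\<^sup>2"
        using Ab[of k]
      proof eventually_elim
        case (elim x)
        have "(h k x)\<^sup>2 \<le> 2 * (A k x * DU k x)\<^sup>2 + 2 * (G k x)\<^sup>2"
          using zero_le_power2[of "A k x * DU k x + G k x"] by (simp add: h_def power2_sum power2_diff)
        moreover have "(A k x)\<^sup>2 \<le> \<beta>\<^sup>2" using power_mono[OF elim, of 2] by simp
        then have "(A k x)\<^sup>2 * (DU k x)\<^sup>2 \<le> \<beta>\<^sup>2 * (DU k x)\<^sup>2" by (intro mult_right_mono) auto
        ultimately show ?case by (simp add: power_mult_distrib)
      qed
    qed (use hL2[of k] DU[of k] G(1)[of k] in \<open>auto simp: L2_intv\<close>)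
    also have "\<dots> = 2 * \<beta>\<^sup>2 * (LINT x|intv L. (DU k x)\<^sup>2) + 2 * (LINT x|intv L. (G k x)\<^sup>2)"
      using DU[of k] G(1)[of k] by (simp add: L2_intv)
    also have "\<dots> \<le> 2 * \<beta>\<^sup>2 * K1 + 2 * c"
      using en1[of k] G(2)[of k] by (intro add_mono mult_left_mono) auto
    finally show ?thesis .
  qed
  have "AE x in intv L. \<forall>k. U k x = prim L (DU k) x"
    unfolding AE_all_countable using H10_prim(1)[OF L H] by blast
  then have limf: "AE x in intv L. (\<lambda>k. ereal (f k x)) \<longlonglongrightarrow> \<phi> (u x)"
    using lim
  proof eventually_elim
    case (elim x)
    then have "(\<lambda>k. prim L (DU k) x) \<longlonglongrightarrow> u x" by simp
    from P(2)[OF this] show ?case by (simp add: f_def)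
  qed
  \<comment> \<open>Where \<open>u x\<close> is nonzero, \<open>\<phi> (u x)\<close> is finite, so
    \<open>f k x\<close> converges and is bounded in \<open>k\<close>. Unboundedness almost
    everywhere would thus force \<open>u\<close> to vanish.\<close>
  have "\<not> (AE x in intv L. \<forall>N. \<exists>k. N < \<bar>f k x\<bar>)"
  proof
    assume "AE x in intv L. \<forall>N. \<exists>k. N < \<bar>f k x\<bar>"
    then have "AE x in intv L. u x = 0"
      using limf
    proof eventually_elim
      case (elim x)
      show ?case
      proof (rule ccontr)
        assume "u x \<noteq> 0"
        then obtain l where "\<phi> (u x) = ereal l"
          using \<phi> unfolding H_phi_def by (cases "\<phi> (u x)") auto
        with elim have "(\<lambda>k. f k x) \<longlonglongrightarrow> l" by simp
        from convergent_imp_bounded[OF this] obtain N where "\<And>k. \<bar>f k x\<bar> \<le> N"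
          unfolding bounded_real by blast
        moreover obtain k where "N < \<bar>f k x\<bar>" using elim by blast
        ultimately show False by (meson not_le)
      qed
    qed
    with nz show False by blast
  qed
  from constants_bounded[OF hL2 hK mf hf this] obtain B where B: "\<And>k. (C k)\<^sup>2 \<le> B" by blast
  have f2: "AE x in intv L. (f k x)\<^sup>2 \<le> 2 * (h k x)\<^sup>2 + 2 * B" for k
    using hf[of k]
  proof eventually_elim
    case (elim x)
    then have "f k x = h k x - C k" by simp
    then show ?case using B[of k] zero_le_power2[of "h k x + C k"] by (simp add: power2_sum power2_diff)
  qed
  have i2: "integrable (intv L) (\<lambda>x. 2 * (h k x)\<^sup>2 + 2 * B)" for k
    using hL2[of k] by (simp add: L2_intv)
  have fL2: "L2 L (f k)" for k
    unfolding L2_intv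
  proof
    show "integrable (intv L) (\<lambda>x. (f k x)\<^sup>2)"
      by (rule Bochner_Integration.integrable_bound[OF i2[of k]])
        (use f2[of k] mf[of k] in \<open>auto elim!: eventually_mono\<close>)
  qed (rule mf)
  have fK: "(LINT x|intv L. (f k x)\<^sup>2) \<le> 2 * (2 * \<beta>\<^sup>2 * K1 + 2 * c) + 2 * B * L" for k
  proof -
    have "(LINT x|intv L. (f k x)\<^sup>2) \<le> (LINT x|intv L. 2 * (h k x)\<^sup>2 + 2 * B)"
      using fL2[of k] i2[of k] f2[of k] by (intro integral_mono_AE) (auto simp: L2_intv)
    also have "\<dots> = 2 * (LINT x|intv L. (h k x)\<^sup>2) + 2 * B * L"
      using hL2[of k] L by (simp add: L2_intv measure_intv)
    finally show ?thesis using hK[of k] by simp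
  qed
  have mu: "u \<in> borel_measurable (intv L)" using Hu by (simp add: H10_def L2_intv)
  have m\<phi>: "(\<lambda>x. \<phi> (u x)) \<in> borel_measurable (intv L)"
    using \<phi> by (intro measurable_compose[OF mu] borel_measurable_continuous_onI) (simp add: H_phi_def)
  have "AE x in intv L. \<phi> (u x) \<noteq> -\<infinity>" using \<phi> by (simp add: H_phi_def)
  note Fat = Fatou_L2[OF fL2 fK m\<phi> this limf]
  have limf': "AE x in intv L. (\<lambda>k. f k x) \<longlonglongrightarrow> real_of_ereal (\<phi> (u x))"
    using limf Fat(1)
  proof eventually_elim
    case (elim x)
    then obtain l where "\<phi> (u x) = ereal l"
      using \<phi> unfolding H_phi_def by (cases "\<phi> (u x)") auto
    with elim show ?case by simp
  qed
  have eq: "(LINT x|intv L. a x * du x * deriv \<psi> x) =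
      (LINT x|intv L. real_of_ereal (\<phi> (u x)) * deriv \<psi> x) + (LINT x|intv L. g x * deriv \<psi> x)"
    if \<psi>: "test_fun L \<psi>" for \<psi>
  proof -
    obtain D where "\<forall>x\<in>{0..L}. \<bar>deriv \<psi> x\<bar> \<le> D" using test_fun_deriv_bounded[OF \<psi>] by blast
    then have D: "AE x in intv L. \<bar>deriv \<psi> x\<bar> \<le> D" by (intro AE_I2) auto
    note m\<psi> = borel_measurable_deriv_test_fun[OF \<psi>] and L2\<psi> = L2_deriv_test_fun[OF \<psi>]
    have e: "(LINT x|intv L. A k x * DU k x * deriv \<psi> x) =
        (LINT x|intv L. f k x * deriv \<psi> x) + (LINT x|intv L. G k x * deriv \<psi> x)" for k
    proof -
      have "(LINT x|intv L. A k x * DU k x * deriv \<psi> x) =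
        (LINT x|intv L. P k (U k x) * deriv \<psi> x) + (LINT x|intv L. G k x * deriv \<psi> x)"
        using sol[of k] H10_test_fun[OF L \<psi>] unfolding approx_sol_def set_lint_intv by blast
      also have "(LINT x|intv L. P k (U k x) * deriv \<psi> x) = (LINT x|intv L. f k x * deriv \<psi> x)"
      proof (rule integral_cong_AE)
        show "AE x in intv L. P k (U k x) * deriv \<psi> x = f k x * deriv \<psi> x"
          using H10_prim(1)[OF L H[of k]] by eventually_elim (simp add: f_def)
        have "U k \<in> borel_measurable (intv L)" using H[of k] by (simp add: H10_def L2_intv)
        then show "(\<lambda>x. P k (U k x) * deriv \<psi> x) \<in> borel_measurable (intv L)"
          by (intro borel_measurable_times m\<psi> measurable_compose[OF _ borel_measurable_continuous_onI[OF P(1)]])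
      qed (intro borel_measurable_times m\<psi> mf)
      finally show ?thesis .
    qed
    have r1: "(\<lambda>k. LINT x|intv L. f k x * deriv \<psi> x) \<longlonglongrightarrow> (LINT x|intv L. real_of_ereal (\<phi> (u x)) * deriv \<psi> x)"
      by (rule tendsto_integral_mult_of_L2_bounded[OF fL2 Fat(2) fK limf' m\<psi> D])
    have r2: "(\<lambda>k. LINT x|intv L. G k x * deriv \<psi> x) \<longlonglongrightarrow> (LINT x|intv L. g x * deriv \<psi> x)"
      using Gg L2\<psi> unfolding weak_conv_L2_def set_lint_intv by blast
    have La: "L2 L (\<lambda>x. a x * deriv \<psi> x)" by (rule L2_bounded_mult[OF L2\<psi> a(1) ab])
    have LA: "L2 L (\<lambda>x. A k x * deriv \<psi> x)" for k by (rule L2_bounded_mult[OF L2\<psi> A(1) Ab])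
    \<comment> \<open>Moving the coefficient to the test function leaves a strong L2 limit, by
      dominated convergence, paired with derivatives that are bounded in L2 and converge
      weakly.\<close>
    define p where "p k x = A k x * deriv \<psi> x - a x * deriv \<psi> x" for k x
    have pL2: "L2 L (p k)" for k unfolding p_def by (intro L2_diff LA La)
    have "(\<lambda>k. LINT x|intv L. (p k x)\<^sup>2) \<longlonglongrightarrow> (LINT x|intv L. 0)"
    proof (rule integral_dominated_convergence[where w = "\<lambda>x. (2 * \<beta> * deriv \<psi> x)\<^sup>2"])
      show "AE x in intv L. (\<lambda>k. (p k x)\<^sup>2) \<longlonglongrightarrow> 0"
        using Aa
      proof eventually_elim
        case (elim x)
        have "(\<lambda>k. p k x) \<longlonglongrightarrow> a x * deriv \<psi> x - a x * deriv \<psi> x"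
          unfolding p_def by (intro tendsto_intros elim)
        then have "(\<lambda>k. (p k x)\<^sup>2) \<longlonglongrightarrow> 0\<^sup>2" by (intro tendsto_power) simp
        then show ?case by simp
      qed
      show "AE x in intv L. norm ((p k x)\<^sup>2) \<le> (2 * \<beta> * deriv \<psi> x)\<^sup>2" for k
        using Ab[of k] ab
      proof eventually_elim
        case (elim x)
        have "\<bar>A k x - a x\<bar> \<le> \<bar>2 * \<beta>\<bar>" using elim by linarith
        then have "\<bar>A k x - a x\<bar> * \<bar>deriv \<psi> x\<bar> \<le> \<bar>2 * \<beta>\<bar> * \<bar>deriv \<psi> x\<bar>" by (intro mult_right_mono) auto
        then have "\<bar>p k x\<bar> \<le> \<bar>2 * \<beta> * deriv \<psi> x\<bar>"
          by (simp add: p_def left_diff_distrib[symmetric] abs_mult)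
        then show ?case by (simp only: abs_le_square_iff real_norm_def abs_power2)
      qed
      show "integrable (intv L) (\<lambda>x. (2 * \<beta> * deriv \<psi> x)\<^sup>2)"
        using L2\<psi> by (simp add: L2_intv power_mult_distrib)
    qed (use pL2 in \<open>auto simp: L2_intv\<close>)
    then have "(\<lambda>k. LINT x|intv L. p k x * DU k x) \<longlonglongrightarrow> 0"
      by (intro tendsto_integral_mult_0[OF pL2 _ DU en1]) simp
    moreover have "(\<lambda>k. LINT x|intv L. DU k x * (a x * deriv \<psi> x)) \<longlonglongrightarrow> (LINT x|intv L. du x * (a x * deriv \<psi> x))"
      by (rule weak_conv_H10_deriv[OF L wc H Hu lim en1 La])
    ultimately have "(\<lambda>k. (LINT x|intv L. p k x * DU k x) + (LINT x|intv L. DU k x * (a x * deriv \<psi> x)))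
        \<longlonglongrightarrow> 0 + (LINT x|intv L. du x * (a x * deriv \<psi> x))"
      by (rule tendsto_add)
    moreover have "(LINT x|intv L. p k x * DU k x) + (LINT x|intv L. DU k x * (a x * deriv \<psi> x))
        = (LINT x|intv L. A k x * DU k x * deriv \<psi> x)" for k
    proof -
      have "(LINT x|intv L. p k x * DU k x) + (LINT x|intv L. DU k x * (a x * deriv \<psi> x))
        = (LINT x|intv L. p k x * DU k x + DU k x * (a x * deriv \<psi> x))"
        by (intro Bochner_Integration.integral_add[symmetric] L2_mult_integrable pL2 DU La)
      also have "\<dots> = (LINT x|intv L. A k x * DU k x * deriv \<psi> x)"
        by (intro Bochner_Integration.integral_cong) (auto simp: p_def algebra_simps)
      finally show ?thesis .
    qed
    ultimately have "(\<lambda>k. LINT x|intv L. A k x * DU k x * deriv \<psi> x) \<longlonglongrightarrow> (LINT x|intv L. du x * (a x * deriv \<psi> x))"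
      by simp
    moreover have "(\<lambda>k. LINT x|intv L. A k x * DU k x * deriv \<psi> x) \<longlonglongrightarrow>
        (LINT x|intv L. real_of_ereal (\<phi> (u x)) * deriv \<psi> x) + (LINT x|intv L. g x * deriv \<psi> x)"
      unfolding e by (intro tendsto_add r1 r2)
    ultimately have "(LINT x|intv L. du x * (a x * deriv \<psi> x)) =
        (LINT x|intv L. real_of_ereal (\<phi> (u x)) * deriv \<psi> x) + (LINT x|intv L. g x * deriv \<psi> x)"
      by (rule LIMSEQ_unique)
    moreover have "(LINT x|intv L. a x * du x * deriv \<psi> x) = (LINT x|intv L. du x * (a x * deriv \<psi> x))"
      by (intro Bochner_Integration.integral_cong) (auto simp: algebra_simps)
    ultimately show ?thesis by simp
  qed
  show ?thesis
    unfolding weak_sol_def set_lint_intv AE_intv[symmetric]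
    using Hu Fat eq by blast
qed

section \<open>Existence, estimate and limit alternative for the approximating data\<close>

theorem mainTheorem1:
  fixes L \<alpha> \<beta> c0 :: real and a g :: "real \<Rightarrow> real" and \<phi> :: "real \<Rightarrow> ereal"
    and an gn \<phi>n :: "nat \<Rightarrow> real \<Rightarrow> real"
  assumes "L > 0" and "H_a L \<alpha> \<beta> a" and "L2 L g" and "H_phi \<phi>" and "\<phi> 0 = \<infinity>"
    and "H_approx L \<alpha> \<beta> c0 a g \<phi> an gn \<phi>n"
  shows "(\<forall>n. \<exists>u du. approx_sol L (an n) (gn n) (\<phi>n n) u du)
    \<and> (\<forall>n u du. approx_sol L (an n) (gn n) (\<phi>n n) u du \<longrightarrow>
          L2norm L du \<le> (1 / \<alpha>) * L2norm L (gn n) \<and> (1 / \<alpha>) * L2norm L (gn n) \<le> c0 / \<alpha>)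
    \<and> (\<forall>r U DU u du. strict_mono r
          \<and> (\<forall>k. approx_sol L (an (r k)) (gn (r k)) (\<phi>n (r k)) (U k) (DU k))
          \<and> H10 L u du \<and> weak_conv_H10 L U DU u du
          \<and> (AE x in lborel. x \<in> {0<..<L} \<longrightarrow> (\<lambda>k. U k x) \<longlonglongrightarrow> u x)
        \<longrightarrow> (AE x in lborel. x \<in> {0<..<L} \<longrightarrow> u x = 0) \<or> weak_sol L a g \<phi> u du)"
proof -
  note L = \<open>L > 0\<close>
  have \<alpha>: "0 < \<alpha>" and a: "a \<in> borel_measurable (intv L)" "AE t in intv L. \<alpha> \<le> a t \<and> a t \<le> \<beta>"
    using assms(2) unfolding H_a_def AE_intv set_borel_measurable_intv by auto
  have A: "an n \<in> borel_measurable (intv L)" "AE t in intv L. \<alpha> \<le> an n t \<and> an n t \<le> \<beta>"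
    and Aa: "AE t in intv L. (\<lambda>n. an n t) \<longlonglongrightarrow> a t"
    and G: "L2 L (gn n)" "L2norm L (gn n) \<le> c0" and Gg: "weak_conv_L2 L gn g"
    and P: "reasonable_approx (\<lambda>n s. ereal (\<phi>n n s)) \<phi>" "continuous_on UNIV (\<phi>n n)" for n
    using assms(6) unfolding H_approx_def AE_intv set_borel_measurable_intv by blast+
  have ex: "\<exists>u du. approx_sol L (an n) (gn n) (\<phi>n n) u du" for n
    by (rule ex_integrated_solution[OF L \<alpha> A G(1) P(2), of n])
      (blast intro: approx_solI[OF L A(1) G(1) P(2)])
  have est: "L2norm L du \<le> (1 / \<alpha>) * L2norm L (gn n) \<and> (1 / \<alpha>) * L2norm L (gn n) \<le> c0 / \<alpha>"
    if "approx_sol L (an n) (gn n) (\<phi>n n) u du" for n u du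
  proof
    have "(LINT t|intv L. (du t)\<^sup>2) \<le> (LINT t|intv L. (gn n t)\<^sup>2) / \<alpha>\<^sup>2"
      by (rule approx_sol_energy[OF L \<alpha> A G(1) P(2) that])
    then show "L2norm L du \<le> (1 / \<alpha>) * L2norm L (gn n)"
      unfolding L2norm_intv using \<alpha> real_sqrt_le_mono by (fastforce simp: real_sqrt_divide)
    show "(1 / \<alpha>) * L2norm L (gn n) \<le> c0 / \<alpha>"
      using G(2)[of n] \<alpha> by (simp add: divide_right_mono)
  qed
  have "(AE x in lborel. x \<in> {0<..<L} \<longrightarrow> u x = 0) \<or> weak_sol L a g \<phi> u du"
    if r: "strict_mono r" and sol: "\<forall>k. approx_sol L (an (r k)) (gn (r k)) (\<phi>n (r k)) (U k) (DU k)"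
      and Hu: "H10 L u du" and wc: "weak_conv_H10 L U DU u du"
      and lim: "AE x in lborel. x \<in> {0<..<L} \<longrightarrow> (\<lambda>k. U k x) \<longlonglongrightarrow> u x"
    for r U DU u du
  proof (rule disjCI)
    assume nz: "\<not> weak_sol L a g \<phi> u du"
    show "AE x in lborel. x \<in> {0<..<L} \<longrightarrow> u x = 0"
    proof (rule ccontr)
      assume nz': "\<not> (AE x in lborel. x \<in> {0<..<L} \<longrightarrow> u x = 0)"
      have "AE t in intv L. (\<lambda>k. an (r k) t) \<longlonglongrightarrow> a t"
        using Aa by eventually_elim (use LIMSEQ_subseq_LIMSEQ[OF _ r] in \<open>simp add: comp_def\<close>)
      moreover have "(LINT x|intv L. (gn n x)\<^sup>2) \<le> c0\<^sup>2" for n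
        using G(2)[of n] unfolding L2norm_intv by (rule sqrt_le_D)
      moreover have "weak_conv_L2 L (\<lambda>k. gn (r k)) g"
        using Gg LIMSEQ_subseq_LIMSEQ[OF _ r] unfolding weak_conv_L2_def comp_def by blast
      moreover have "(\<lambda>k. ereal (\<phi>n (r k) (s k))) \<longlonglongrightarrow> \<phi> s0" if "s \<longlonglongrightarrow> s0" for s s0
        by (rule reasonable_approx_subseq[OF P(1) r that])
      ultimately have "weak_sol L a g \<phi> u du"
        by (intro weak_sol_of_limit[OF L \<alpha> a, where A = "\<lambda>k. an (r k)" and G = "\<lambda>k. gn (r k)"
              and P = "\<lambda>k. \<phi>n (r k)" and U = U and DU = DU and c = "c0\<^sup>2"])
          (use A G(1) P(2) assms(4) sol Hu wc lim nz' in \<open>auto simp: AE_intv\<close>)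
      with nz show False by blast
    qed
  qed
  with ex est show ?thesis by blast
qed

end
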